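(* Let $\Omega\subset\mathbb{C}$ be a bounded simply connected domain, $a,b\in L_\infty(\Omega;\mathbb{B})$, and $1<p\leqslant\infty$. For every compact set $K\subset\Omega$ there exists a constant $C_K>0$ such that $$\max_{z\in K}|W(z)|_{\mathbb{B}}\leqslant C_K\|W\|_{L_p(\Omega;\mathbb{B})}\qquad\text{for all } W\in\mathcal{A}_{(a,b)}^p(\Omega;\mathbb{B}).$$
   Context: $\mathbb{B}=\{u+\mathbf{j}v : u,v\in\mathbb{C}\}$ is the commutative $\mathbb{C}$-algebra of bicomplex numbers, with $\mathbf{j}^2=-1$ and $i\mathbf{j}=\mathbf{j}i$. For $W=u+\mathbf{j}v$: $\operatorname{Sc}W=u$, $\operatorname{Vec}W=v$, $\overline{W}=u-\mathbf{j}v$, $|W|_{\mathbb{B}}=\sqrt{|u|^2+|v|^2}$. A function $F:\Omega\to\mathbb{B}$ belongs to $\mathscr{F}(\Omega;\mathbb{B})$ (for a space $\mathscr{F}(\Omega)$ of complex-valued functions) iff $\operatorname{Sc}F,\operatorname{Vec}F\in\mathscr{F}(\Omega)$. $L_p(\Omega;\mathbb{B})$ has norm $\left(\iint_\Omega|F|_{\mathbb{B}}^p\,dA\right)^{1/p}$ (essential supremum of $|F|_{\mathbb{B}}$ if $p=\infty$). With $z=x+iy$, $\overline{\boldsymbol{\partial}}=\frac12\left(\frac{\partial}{\partial x}+\mathbf{j}\frac{\partial}{\partial y}\right)$. A function $V\in L_{1,loc}(\Omega;\mathbb{B})$ is the weak $\overline{\boldsymbol{\partial}}$-derivative of $W\in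 L_p(\Omega;\mathbb{B})$ if $\iint_\Omega W\,\overline{\boldsymbol{\partial}}\phi\,dA=-\iint_\Omega V\phi\,dA$ for all $\phi\in C_0^\infty(\Omega;\mathbb{B})$. The Vekua-Bergman space $\mathcal{A}_{(a,b)}^p(\Omega;\mathbb{B})$ is the set of all weak solutions $W\in L_p(\Omega;\mathbb{B})$ of $\overline{\boldsymbol{\partial}}W=aW+b\overline{W}$ in $\Omega$. Every such $W$ has a continuous representative in $\Omega$, and $W(z)$ denotes its value. *)

theory Defs
  imports "HOL-Analysis.Analysis" "HOL-Probability.Essential_Supremum"
begin

section \<open>Bicomplex numbers\<close>

codatatype bicomplex = Bicomplex (Sc: complex) (Vec: complex)

lemma bicomplex_eq_iff: "x = y \<longleftrightarrow> Sc x = Sc y \<and> Vec x = Vec y"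
  by (auto intro: bicomplex.expand)

instantiation bicomplex :: comm_ring_1
begin

primcorec zero_bicomplex where
  "Sc 0 = 0"
| "Vec 0 = 0"

primcorec one_bicomplex where
  "Sc 1 = 1"
| "Vec 1 = 0"

primcorec plus_bicomplex where
  "Sc (x + y) = Sc x + Sc y"
| "Vec (x + y) = Vec x + Vec y"

primcorec uminus_bicomplex where
  "Sc (- x) = - Sc x"
| "Vec (- x) = - Vec x"

primcorec minus_bicomplex where
  "Sc (x - y) = Sc x - Sc y"
| "Vec (x - y) = Vec x - Vec y"

primcorec times_bicomplex where
  "Sc (x * y) = Sc x * Sc y - Vec x * Vec y"
| "Vec (x * y) = Sc x * Vec y + Vec x * Sc y"

instance
  by standard (simp_all add: bicomplex_eq_iff algebra_simps)

end

instantiation bicomplex :: real_algebra_1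
begin

primcorec scaleR_bicomplex where
  "Sc (scaleR r x) = scaleR r (Sc x)"
| "Vec (scaleR r x) = scaleR r (Vec x)"

instance
  by standard (simp_all add: bicomplex_eq_iff algebra_simps)

end

text \<open>The Euclidean norm below is not submultiplicative (there are zero divisors), so
  \<^typ>\<open>bicomplex\<close> is a normed vector space but not a normed algebra in the sense of the library.\<close>

instantiation bicomplex :: real_inner
begin

definition norm_bicomplex :: "bicomplex \<Rightarrow> real" where
  "norm W = sqrt ((cmod (Sc W))\<^sup>2 + (cmod (Vec W))\<^sup>2)"

definition inner_bicomplex :: "bicomplex \<Rightarrow> bicomplex \<Rightarrow> real" where
  "inner x y = inner (Sc x) (Sc y) + inner (Vec x) (Vec y)"

definition sgn_bicomplex :: "bicomplex \<Rightarrow> bicomplex" where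
  "sgn x = (x :: bicomplex) /\<^sub>R norm x"

definition dist_bicomplex :: "bicomplex \<Rightarrow> bicomplex \<Rightarrow> real" where
  "dist x y = norm (x - y :: bicomplex)"

definition uniformity_bicomplex :: "(bicomplex \<times> bicomplex) filter" where
  "(uniformity :: (bicomplex \<times> bicomplex) filter) = (INF e\<in>{0 <..}. principal {(x, y). dist x y < e})"

definition open_bicomplex :: "bicomplex set \<Rightarrow> bool" where
  "open (U :: bicomplex set) \<longleftrightarrow> (\<forall>x\<in>U. eventually (\<lambda>(x', y). x' = x \<longrightarrow> y \<in> U) uniformity)"

instance
proof
  fix r :: real and x y z :: bicomplex
  show "inner x y = inner y x"
    by (simp add: inner_bicomplex_def inner_commute)
  show "inner (x + y) z = inner x z + inner y z"
    by (simp add: inner_bicomplex_def inner_add_left)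
  show "inner (scaleR r x) y = r * inner x y"
    by (simp add: inner_bicomplex_def distrib_left)
  show "0 \<le> inner x x"
    by (simp add: inner_bicomplex_def)
  show "inner x x = 0 \<longleftrightarrow> x = 0"
    by (simp add: inner_bicomplex_def bicomplex_eq_iff add_nonneg_eq_0_iff)
  show "norm x = sqrt (inner x x)"
    by (simp add: inner_bicomplex_def norm_bicomplex_def power2_norm_eq_inner)
qed (rule sgn_bicomplex_def dist_bicomplex_def uniformity_bicomplex_def open_bicomplex_def)+

end

instantiation bicomplex :: euclidean_space
begin

definition Basis_bicomplex :: "bicomplex set" where
  "Basis = (\<lambda>u. Bicomplex u 0) ` Basis \<union> (\<lambda>v. Bicomplex 0 v) ` Basis"

instance
proof
  show "(Basis :: bicomplex set) \<noteq> {}" "finite (Basis :: bicomplex set)"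
    by (simp_all add: Basis_bicomplex_def)
next
  fix u v :: bicomplex
  assume "u \<in> Basis" and "v \<in> Basis"
  thus "inner u v = (if u = v then 1 else 0)"
    unfolding Basis_bicomplex_def inner_bicomplex_def
    by (auto simp add: inner_Basis split: if_split_asm)
next
  fix x :: bicomplex
  show "(\<forall>u\<in>Basis. inner x u = 0) \<longleftrightarrow> x = 0"
    unfolding Basis_bicomplex_def ball_Un ball_simps inner_bicomplex_def
    by (simp add: bicomplex_eq_iff euclidean_all_zero_iff)
qed

end

definition bj :: bicomplex where
  "bj = Bicomplex 0 1"

definition bcnj :: "bicomplex \<Rightarrow> bicomplex" where
  "bcnj W = Bicomplex (Sc W) (- Vec W)"

lemma bj_squared: "bj * bj = - 1"
  by (simp add: bj_def bicomplex_eq_iff)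

lemma bicomplex_decompose: "W = Bicomplex (Sc W) 0 + bj * Bicomplex (Vec W) 0"
  by (simp add: bj_def bicomplex_eq_iff)

section \<open>Function spaces\<close>

text \<open>Functions on a domain are total functions; only their values on the domain matter. Elements
  of the Lebesgue spaces are represented by functions rather than by classes modulo null sets.\<close>

definition bc_space :: "(complex \<Rightarrow> complex) set \<Rightarrow> (complex \<Rightarrow> bicomplex) set" where
  "bc_space \<F> = {F. (\<lambda>z. Sc (F z)) \<in> \<F> \<and> (\<lambda>z. Vec (F z)) \<in> \<F>}"

definition Lp :: "ennreal \<Rightarrow> complex set \<Rightarrow> (complex \<Rightarrow> complex) set" where
  "Lp p \<Omega> = {f \<in> borel_measurable (lebesgue_on \<Omega>).
     if p = \<infinity> then esssup (lebesgue_on \<Omega>) (\<lambda>z. ennreal (cmod (f z))) < \<infinity>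
     else integrable (lebesgue_on \<Omega>) (\<lambda>z. cmod (f z) powr enn2real p)}"

definition Lp_norm :: "ennreal \<Rightarrow> complex set \<Rightarrow> (complex \<Rightarrow> bicomplex) \<Rightarrow> real" where
  "Lp_norm p \<Omega> F =
     (if p = \<infinity> then enn2real (esssup (lebesgue_on \<Omega>) (\<lambda>z. ennreal (norm (F z))))
      else (LINT z|lebesgue_on \<Omega>. norm (F z) powr enn2real p) powr (1 / enn2real p))"

definition L1_loc :: "complex set \<Rightarrow> (complex \<Rightarrow> complex) set" where
  "L1_loc \<Omega> = {f. \<forall>K. compact K \<and> K \<subseteq> \<Omega> \<longrightarrow> integrable (lebesgue_on K) f}"

definition partial_x :: "(complex \<Rightarrow> 'a::real_normed_vector) \<Rightarrow> complex \<Rightarrow> 'a" where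
  "partial_x f z = vector_derivative (\<lambda>t. f (z + of_real t)) (at 0)"

definition partial_y :: "(complex \<Rightarrow> 'a::real_normed_vector) \<Rightarrow> complex \<Rightarrow> 'a" where
  "partial_y f z = vector_derivative (\<lambda>t. f (z + \<i> * of_real t)) (at 0)"

text \<open>Note that \<^const>\<open>differentiable_on\<close> is Frechet differentiability over the reals.\<close>

primrec Ck_on :: "nat \<Rightarrow> complex set \<Rightarrow> (complex \<Rightarrow> complex) \<Rightarrow> bool" where
  "Ck_on 0 \<Omega> f \<longleftrightarrow> continuous_on \<Omega> f"
| "Ck_on (Suc n) \<Omega> f \<longleftrightarrow>
     f differentiable_on \<Omega> \<and> Ck_on n \<Omega> (partial_x f) \<and> Ck_on n \<Omega> (partial_y f)"

definition test_functions :: "complex set \<Rightarrow> (complex \<Rightarrow> complex) set" where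
  "test_functions \<Omega> = {\<phi>. (\<forall>n. Ck_on n \<Omega> \<phi>) \<and>
     (\<exists>K. compact K \<and> K \<subseteq> \<Omega> \<and> (\<forall>z\<in>\<Omega> - K. \<phi> z = 0))}"

section \<open>The Vekua equation\<close>

definition dbar :: "(complex \<Rightarrow> bicomplex) \<Rightarrow> complex \<Rightarrow> bicomplex" where
  "dbar \<phi> z = (1/2) *\<^sub>R (partial_x \<phi> z + bj * partial_y \<phi> z)"

definition weak_dbar ::
    "complex set \<Rightarrow> (complex \<Rightarrow> bicomplex) \<Rightarrow> (complex \<Rightarrow> bicomplex) \<Rightarrow> bool" where
  "weak_dbar \<Omega> W V \<longleftrightarrow> V \<in> bc_space (L1_loc \<Omega>) \<and>
     (\<forall>\<phi>\<in>bc_space (test_functions \<Omega>).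
        (LINT z|lebesgue_on \<Omega>. W z * dbar \<phi> z) = - (LINT z|lebesgue_on \<Omega>. V z * \<phi> z))"

definition vekua_bergman ::
    "ennreal \<Rightarrow> complex set \<Rightarrow> (complex \<Rightarrow> bicomplex) \<Rightarrow> (complex \<Rightarrow> bicomplex) \<Rightarrow>
     (complex \<Rightarrow> bicomplex) set" where
  "vekua_bergman p \<Omega> a b =
     {W \<in> bc_space (Lp p \<Omega>). weak_dbar \<Omega> W (\<lambda>z. a z * W z + b z * bcnj (W z))}"

definition continuous_rep ::
    "complex set \<Rightarrow> (complex \<Rightarrow> bicomplex) \<Rightarrow> (complex \<Rightarrow> bicomplex) \<Rightarrow> bool" where
  "continuous_rep \<Omega> W V \<longleftrightarrow> continuous_on \<Omega> V \<and> (AE z in lebesgue_on \<Omega>. V z = W z)"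

end

(*
  Write jc (x + iy) = x + jy. This is an isometric ring homomorphism from the complex numbers into
  the bicomplex numbers, |W jc w| = |W| |w|, and jc (1 / z) / pi is a fundamental solution of the
  bicomplex d-bar operator. Its regularization jc (cnj w) / (|w|^2 + e), multiplied by a smooth
  radial cutoff chi, is an admissible test function, and its d-bar derivative is the approximate
  identity e / (|w|^2 + e)^2. Letting e -> 0 gives, for almost every zeta near z0,
    c chi(zeta) W(zeta) = - int (chi (a W + b bcnj W) + W dbar chi)(z) jc (1 / (z - zeta)) dA(z),
  with c the total mass of (1 + |w|^2)^(-2). Hence |W| <= C (1 / |.|) * |W| on slightly smaller
  balls. Three such steps suffice: the kernel 1 / |.| iterated twice is at most C |.|^(-1/2), and
  iterated three times it is bounded, so |W| <= C ||W||_1 almost everywhere. The right-hand side of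
  the formula is then a potential of a bounded function and hence Hoelder continuous with exponent
  1/2, which yields the continuous representative and its bound.
*)
theory Submission
  imports Defs "HOL-Computational_Algebra.Polynomial"
begin

text \<open>The weak equation may only be tested with smooth compactly supported functions, which
  excludes the singular kernel itself; the parameter e buys admissibility. The limit e -> 0 is not
  taken pointwise: W is merely integrable at that stage, so both sides are integrated in zeta over
  an arbitrary box. Fubini's theorem then transfers the approximate identity onto the indicator of
  the box, where convergence off the frontier is elementary, and the singular double integral
  converges absolutely. Lebesgue differentiation removes the box. All kernel estimates rest on the
  single integrable kernel |w|^(-3/2) and on u v^2 <= u^3 + v^3. Two kernels 1/|.| really compose to
  a logarithm; the cruder power -1/2 is what this inequality yields without one. The cutoff exp (-1
  / (s^2 - |z - z0|^2)) is nowhere equal to 1, but a positive lower bound on a smaller ball is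
  enough to divide by it. The constants depend on a and b only through M with |a W + b bcnj W| <= M
  |W|, and not on W, so finitely many balls covering K give one constant.\<close>

definition jc :: "complex \<Rightarrow> bicomplex" where
  "jc w = Bicomplex (of_real (Re w)) (of_real (Im w))"

lemma Sc_jc [simp]: "Sc (jc w) = of_real (Re w)" and Vec_jc [simp]: "Vec (jc w) = of_real (Im w)"
  by (simp_all add: jc_def)

lemma jc_1 [simp]: "jc 1 = 1"
  by (simp add: bicomplex_eq_iff)

lemma jc_add: "jc (v + w) = jc v + jc w"
  by (simp add: bicomplex_eq_iff)

lemma jc_diff: "jc (v - w) = jc v - jc w"
  by (simp add: bicomplex_eq_iff)

lemma jc_scaleR: "jc (r *\<^sub>R w) = r *\<^sub>R jc w"
  by (simp add: bicomplex_eq_iff complex_eq_iff)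

text \<open>For W = u + jv and w = x + iy the components of the product are ux - vy and uy + vx.
  Since x and y are real, the cross terms of the two squared moduli cancel, leaving (|u|^2 +
  |v|^2)(x^2 + y^2). Such multiplicativity fails for general bicomplex factors; here it keeps the
  kernel estimates free of constants.\<close>

lemma norm_mult_jc: "norm (W * jc w) = norm W * cmod w"
proof -
  have "(norm (W * jc w))\<^sup>2 = (norm W * cmod w)\<^sup>2"
    unfolding norm_bicomplex_def power_mult_distrib
    by (simp add: cmod_power2) (simp add: power2_eq_square algebra_simps)
  then show ?thesis
    by (metis norm_ge_zero power2_eq_iff_nonneg zero_le_mult_iff)
qed

lemma norm_one_bicomplex: "norm (1::bicomplex) = 1"
  by (simp add: norm_bicomplex_def)

lemma norm_jc [simp]: "norm (jc w) = cmod w"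
  using norm_mult_jc[of 1 w] by (simp add: norm_one_bicomplex)

lemma norm_Sc_le: "cmod (Sc W) \<le> norm W" and norm_Vec_le: "cmod (Vec W) \<le> norm W"
  by (simp_all add: norm_bicomplex_def real_le_rsqrt)

lemma norm_bicomplex_le: "norm W \<le> cmod (Sc W) + cmod (Vec W)"
  unfolding norm_bicomplex_def by (rule sqrt_sum_squares_le_sum) auto

text \<open>Four products of components occur, each at most \<open>norm U * norm V\<close>. The
  crude factor 4 reappears in the constant M attached to the Vekua equation.\<close>

lemma norm_bicomplex_mult_le: "norm (U * V) \<le> 4 * (norm U * norm V)" for U V :: bicomplex
proof -
  have "norm (U * V) \<le> cmod (Sc U) * cmod (Sc V) + cmod (Vec U) * cmod (Vec V)
      + (cmod (Sc U) * cmod (Vec V) + cmod (Vec U) * cmod (Sc V))"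
    by (rule order_trans[OF norm_bicomplex_le])
       (auto intro!: add_mono order_trans[OF norm_triangle_ineq4] order_trans[OF norm_triangle_ineq]
          simp: norm_mult)
  also have "\<dots> \<le> norm U * norm V + norm U * norm V + (norm U * norm V + norm U * norm V)"
    by (intro add_mono mult_mono norm_Sc_le norm_Vec_le) auto
  finally show ?thesis by simp
qed

lemma norm_bcnj [simp]: "norm (bcnj W) = norm W"
  by (simp add: norm_bicomplex_def bcnj_def)

lemma bounded_bilinear_bicomplex_mult: "bounded_bilinear ((*) :: bicomplex \<Rightarrow> bicomplex \<Rightarrow> bicomplex)"
  by (rule bounded_bilinear.intro)
     (auto simp: algebra_simps intro!: exI[of _ 4] order_trans[OF norm_bicomplex_mult_le])

lemma bounded_linear_jc: "bounded_linear jc"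
  by (rule bounded_linear_intro[where K = 1]) (auto simp: jc_add jc_scaleR)

lemma bounded_linear_Sc: "bounded_linear Sc"
  by (rule bounded_linear_intro[where K = 1]) (auto simp: norm_Sc_le)

lemma bounded_linear_Vec: "bounded_linear Vec"
  by (rule bounded_linear_intro[where K = 1]) (auto simp: norm_Vec_le)

lemma Sc_bcnj [simp]: "Sc (bcnj W) = Sc W" and Vec_bcnj [simp]: "Vec (bcnj W) = - Vec W"
  by (simp_all add: bcnj_def)

lemma bounded_linear_bcnj: "bounded_linear bcnj"
  by (rule bounded_linear_intro[where K = 1]) (auto simp: bicomplex_eq_iff)

section \<open>Measurability of bicomplex operations\<close>

lemma borel_measurable_bicomplex_mult [measurable (raw)]:
  assumes "f \<in> borel_measurable M" "g \<in> borel_measurable M"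
  shows "(\<lambda>x. f x * g x :: bicomplex) \<in> borel_measurable M"
  by (rule borel_measurable_continuous_Pair[OF assms])
     (intro bounded_bilinear.continuous_on[OF bounded_bilinear_bicomplex_mult] continuous_intros)

lemma borel_measurable_jc [measurable (raw)]:
  "f \<in> borel_measurable M \<Longrightarrow> (\<lambda>x. jc (f x)) \<in> borel_measurable M"
  by (rule measurable_compose[OF _ borel_measurable_continuous_onI])
     (auto intro: linear_continuous_on bounded_linear_jc)

lemma borel_measurable_bcnj [measurable (raw)]:
  "f \<in> borel_measurable M \<Longrightarrow> (\<lambda>x. bcnj (f x)) \<in> borel_measurable M"
  by (rule measurable_compose[OF _ borel_measurable_continuous_onI])
     (auto intro: linear_continuous_on bounded_linear_bcnj)

lemma borel_measurable_Sc [measurable (raw)]: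
  "f \<in> borel_measurable M \<Longrightarrow> (\<lambda>x. Sc (f x)) \<in> borel_measurable M"
  by (rule measurable_compose[OF _ borel_measurable_continuous_onI])
     (auto intro: linear_continuous_on bounded_linear_Sc)

lemma borel_measurable_Vec [measurable (raw)]:
  "f \<in> borel_measurable M \<Longrightarrow> (\<lambda>x. Vec (f x)) \<in> borel_measurable M"
  by (rule measurable_compose[OF _ borel_measurable_continuous_onI])
     (auto intro: linear_continuous_on bounded_linear_Vec)

text \<open>Coordinates in a real basis: measurability and Borel versions of bicomplex functions are
  assembled from four real functions.\<close>

lemma bicomplex_decompose_scaleR:
  "W = Re (Sc W) *\<^sub>R Bicomplex 1 0 + Im (Sc W) *\<^sub>R Bicomplex \<i> 0 +
       Re (Vec W) *\<^sub>R Bicomplex 0 1 + Im (Vec W) *\<^sub>R Bicomplex 0 \<i>"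
  by (simp add: bicomplex_eq_iff complex_eq_iff)

lemma borel_measurable_bicomplexI:
  assumes "(\<lambda>x. Sc (f x)) \<in> borel_measurable M" "(\<lambda>x. Vec (f x)) \<in> borel_measurable M"
  shows "f \<in> borel_measurable M"
proof -
  note [measurable] = assms
  have "(\<lambda>x. Re (Sc (f x)) *\<^sub>R Bicomplex 1 0 + Im (Sc (f x)) *\<^sub>R Bicomplex \<i> 0 +
       Re (Vec (f x)) *\<^sub>R Bicomplex 0 1 + Im (Vec (f x)) *\<^sub>R Bicomplex 0 \<i>) \<in> borel_measurable M"
    by measurable
  then show ?thesis
    by (simp flip: bicomplex_decompose_scaleR)
qed

section \<open>Smooth functions\<close>

text \<open>With P = 1 this is the classical flat function exp (-1/t), extended by 0. The polynomial
  in 1/t is carried along because differentiation produces such factors, so the family is closed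
  under derivatives.\<close>

definition bump :: "real poly \<Rightarrow> real \<Rightarrow> real" where
  "bump P t = (if t > 0 then poly P (1 / t) * exp (- (1 / t)) else 0)"

lemma poly_exp_tendsto_0: "((\<lambda>s. poly P s * exp (- s)) \<longlongrightarrow> (0::real)) at_top"
proof -
  have "((\<lambda>s::real. \<Sum>i\<le>degree P. coeff P i * (s ^ i / exp s)) \<longlongrightarrow> (\<Sum>i\<le>degree P. coeff P i * 0)) at_top"
    by (intro tendsto_intros tendsto_power_div_exp_0)
  then show ?thesis
    by (simp add: poly_altdef sum_distrib_right exp_minus divide_inverse mult.assoc)
qed

text \<open>For t > 0 the derivative of P(1/t) exp (-1/t) is t^(-2) (P - P')(1/t) exp (-1/t), and
  \<open>[:0, 0, 1:]\<close> is the polynomial s^2 that stands for t^(-2).\<close>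

lemma DERIV_bump:
  "(bump P has_real_derivative bump ([:0, 0, 1:] * (P - pderiv P)) t) (at t)"
proof -
  consider "t > 0" | "t < 0" | "t = 0" by linarith
  then show ?thesis
  proof cases
    case 1
    have "((\<lambda>t. poly P (1 / t) * exp (- (1 / t))) has_real_derivative
        bump ([:0, 0, 1:] * (P - pderiv P)) t) (at t)"
      using 1 by (auto intro!: derivative_eq_intros simp: bump_def field_simps power2_eq_square)
    then show ?thesis
      by (rule DERIV_cong_ev[THEN iffD1, rotated -1])
         (use 1 eventually_nhds_in_open[of "{0<..}" t] in
            \<open>auto elim!: eventually_mono simp: bump_def\<close>)
  next
    case 2
    have "((\<lambda>t. 0) has_real_derivative bump ([:0, 0, 1:] * (P - pderiv P)) t) (at t)"
      using 2 by (simp add: bump_def)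
    then show ?thesis
      by (rule DERIV_cong_ev[THEN iffD1, rotated -1])
         (use 2 eventually_nhds_in_open[of "{..<0}" t] in
            \<open>auto elim!: eventually_mono simp: bump_def\<close>)
  next
    case 3
    \<comment> \<open>With s = 1/h the right difference quotient at 0 is s P(s) exp (-s), and
      \<open>pCons 0 P\<close> is the polynomial s P(s).\<close>
    have "((\<lambda>h. poly (pCons 0 P) (inverse h) * exp (- inverse h)) \<longlongrightarrow> 0) (at_right (0::real))"
      by (rule filterlim_compose[OF poly_exp_tendsto_0 filterlim_inverse_at_top_right])
    then have right: "((\<lambda>h. bump P h / h) \<longlongrightarrow> 0) (at_right 0)"
      by (rule Lim_transform_eventually)
         (auto simp: eventually_at_right_field bump_def field_simps intro!: exI[of _ 1])
    have left: "((\<lambda>h. bump P h / h) \<longlongrightarrow> 0) (at_left 0)"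
      by (rule Lim_transform_eventually[OF tendsto_const])
         (auto simp: eventually_at_left_field bump_def intro!: exI[of _ "-1"])
    have "((\<lambda>h. bump P h / h) \<longlongrightarrow> 0) (at 0)"
      using left right by (simp add: filterlim_split_at)
    then show ?thesis
      using 3 by (simp add: DERIV_def) (simp add: bump_def)
  qed
qed

text \<open>Being closed under partial derivatives, this class makes \<^const>\<open>Ck_on\<close> a plain induction.\<close>

inductive_set smooth_fns :: "(complex \<Rightarrow> real) set" where
  const: "(\<lambda>z. c) \<in> smooth_fns"
| Re: "Re \<in> smooth_fns"
| Im: "Im \<in> smooth_fns"
| add: "f \<in> smooth_fns \<Longrightarrow> g \<in> smooth_fns \<Longrightarrow> (\<lambda>z. f z + g z) \<in> smooth_fns"
| mult: "f \<in> smooth_fns \<Longrightarrow> g \<in> smooth_fns \<Longrightarrow> (\<lambda>z. f z * g z) \<in> smooth_fns"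
| bump: "f \<in> smooth_fns \<Longrightarrow> (\<lambda>z. bump P (f z)) \<in> smooth_fns"
| inverse: "f \<in> smooth_fns \<Longrightarrow> (\<And>z. f z > 0) \<Longrightarrow> (\<lambda>z. inverse (f z)) \<in> smooth_fns"

text \<open>Total differentiability written through the two partials: \<open>Ck_on\<close> asks for
  \<open>differentiable_on\<close>, which existence of partial derivatives alone would not
  give.\<close>

definition has_partials :: "(complex \<Rightarrow> real) \<Rightarrow> (complex \<Rightarrow> real) \<Rightarrow> (complex \<Rightarrow> real) \<Rightarrow> bool" where
  "has_partials f fx fy \<longleftrightarrow> (\<forall>z. (f has_derivative (\<lambda>h. Re h * fx z + Im h * fy z)) (at z))"

lemma has_partialsD:
  "has_partials f fx fy \<Longrightarrow> (f has_derivative (\<lambda>h. Re h * fx z + Im h * fy z)) (at z)"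
  by (simp add: has_partials_def)

lemma smooth_fns_partials:
  assumes "f \<in> smooth_fns"
  shows "\<exists>fx\<in>smooth_fns. \<exists>fy\<in>smooth_fns. has_partials f fx fy"
  using assms
proof induction
  case (const c)
  show ?case
    by (intro bexI[of _ "\<lambda>z. 0"]) (auto simp: has_partials_def intro: smooth_fns.const)
next
  case Re
  show ?case
    by (intro bexI[of _ "\<lambda>z. 1"] bexI[of _ "\<lambda>z. 0"])
       (auto simp: has_partials_def intro: smooth_fns.const bounded_linear_imp_has_derivative bounded_linear_Re)
next
  case Im
  show ?case
    by (intro bexI[of _ "\<lambda>z. 0"] bexI[of _ "\<lambda>z. 1"])
       (auto simp: has_partials_def intro: smooth_fns.const bounded_linear_imp_has_derivative bounded_linear_Im)
next
  case (add f g)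
  from add.IH obtain fx fy gx gy where S: "fx \<in> smooth_fns" "fy \<in> smooth_fns" "gx \<in> smooth_fns" "gy \<in> smooth_fns"
    and D: "has_partials f fx fy" "has_partials g gx gy"
    by (elim bexE)
  have "has_partials (\<lambda>z. f z + g z) (\<lambda>z. fx z + gx z) (\<lambda>z. fy z + gy z)"
    unfolding has_partials_def
    by (intro allI has_derivative_eq_rhs[OF has_derivative_add[OF D[THEN has_partialsD]]])
       (simp add: algebra_simps)
  moreover have "(\<lambda>z. fx z + gx z) \<in> smooth_fns" "(\<lambda>z. fy z + gy z) \<in> smooth_fns"
    by (intro smooth_fns.add S)+
  ultimately show ?case
    by (intro bexI)
next
  case (mult f g)
  from mult.IH obtain fx fy gx gy where S: "fx \<in> smooth_fns" "fy \<in> smooth_fns" "gx \<in> smooth_fns" "gy \<in> smooth_fns"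
    and D: "has_partials f fx fy" "has_partials g gx gy"
    by (elim bexE)
  have "has_partials (\<lambda>z. f z * g z) (\<lambda>z. f z * gx z + fx z * g z) (\<lambda>z. f z * gy z + fy z * g z)"
    unfolding has_partials_def
    by (intro allI has_derivative_eq_rhs[OF has_derivative_mult[OF D[THEN has_partialsD]]])
       (simp add: algebra_simps)
  moreover have "(\<lambda>z. f z * gx z + fx z * g z) \<in> smooth_fns" "(\<lambda>z. f z * gy z + fy z * g z) \<in> smooth_fns"
    by (intro smooth_fns.add smooth_fns.mult S mult.hyps)+
  ultimately show ?case
    by (intro bexI)
next
  case (bump f P)
  from bump.IH obtain fx fy where S: "fx \<in> smooth_fns" "fy \<in> smooth_fns" and D: "has_partials f fx fy"
    by (elim bexE)
  let ?Q = "[:0, 0, 1:] * (P - pderiv P)"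
  have "has_partials (\<lambda>z. bump P (f z)) (\<lambda>z. bump ?Q (f z) * fx z) (\<lambda>z. bump ?Q (f z) * fy z)"
    unfolding has_partials_def
    by (intro allI has_derivative_eq_rhs[OF DERIV_compose_FDERIV[OF DERIV_bump D[THEN has_partialsD]]])
       (simp only: distrib_left distrib_right mult_ac)
  moreover have "(\<lambda>z. bump ?Q (f z) * fx z) \<in> smooth_fns" "(\<lambda>z. bump ?Q (f z) * fy z) \<in> smooth_fns"
    by (intro smooth_fns.bump smooth_fns.mult S bump.hyps)+
  ultimately show ?case
    by (intro bexI)
next
  case (inverse f)
  from inverse.IH obtain fx fy where S: "fx \<in> smooth_fns" "fy \<in> smooth_fns" and D: "has_partials f fx fy"
    by (elim bexE)
  let ?g = "\<lambda>z. (-1) * (inverse (f z) * inverse (f z))"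
  have "has_partials (\<lambda>z. inverse (f z)) (\<lambda>z. ?g z * fx z) (\<lambda>z. ?g z * fy z)"
    unfolding has_partials_def
  proof
    fix z
    have "f z \<noteq> 0" using inverse.hyps(2)[of z] by simp
    from Deriv.has_derivative_inverse[OF this D[THEN has_partialsD]]
    show "((\<lambda>z. inverse (f z)) has_derivative (\<lambda>h. Re h * (?g z * fx z) + Im h * (?g z * fy z))) (at z)"
      by (rule has_derivative_eq_rhs) (simp add: fun_eq_iff algebra_simps)
  qed
  moreover have "(\<lambda>z. ?g z * fx z) \<in> smooth_fns" "(\<lambda>z. ?g z * fy z) \<in> smooth_fns"
    by (intro smooth_fns.inverse smooth_fns.mult smooth_fns.const S inverse.hyps)+
  ultimately show ?case
    by (intro bexI)
qed

lemma partial_x_has_derivative: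
  assumes "(f has_derivative f') (at z)"
  shows "partial_x f z = f' 1"
proof -
  have "((\<lambda>t. f (z + of_real t)) has_derivative (\<lambda>t. f' (of_real t))) (at (0::real))"
    by (rule has_derivative_compose[where g = f]) (auto intro!: derivative_eq_intros assms)
  moreover have "f' (of_real t) = t *\<^sub>R f' 1" for t :: real
    using linear_cmul[OF has_derivative_linear[OF assms], of t 1] by (simp add: scaleR_conv_of_real)
  ultimately show ?thesis
    unfolding partial_x_def by (intro vector_derivative_at) (simp add: has_vector_derivative_def)
qed

lemma partial_y_has_derivative:
  assumes "(f has_derivative f') (at z)"
  shows "partial_y f z = f' \<i>"
proof -
  have "((\<lambda>t. f (z + \<i> * of_real t)) has_derivative (\<lambda>t. f' (\<i> * of_real t))) (at (0::real))"
    by (rule has_derivative_compose[where g = f]) (auto intro!: derivative_eq_intros assms)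
  moreover have "f' (\<i> * of_real t) = t *\<^sub>R f' \<i>" for t :: real
    using linear_cmul[OF has_derivative_linear[OF assms], of t \<i>]
    by (simp add: scaleR_conv_of_real mult.commute)
  ultimately show ?thesis
    unfolding partial_y_def by (intro vector_derivative_at) (simp add: has_vector_derivative_def)
qed

lemma Ck_on_smooth_fns:
  "f \<in> smooth_fns \<Longrightarrow> Ck_on n \<Omega> (\<lambda>z. of_real (f z))"
proof (induction n arbitrary: f)
  case 0
  from smooth_fns_partials[OF 0] obtain fx fy where D: "has_partials f fx fy"
    by (elim bexE)
  have "continuous_on \<Omega> f"
    by (intro continuous_at_imp_continuous_on ballI has_derivative_continuous[OF has_partialsD[OF D]])
  then show ?case by (simp add: continuous_on_of_real)
next
  case (Suc n)
  from smooth_fns_partials[OF Suc.prems] obtain fx fy where S: "fx \<in> smooth_fns" "fy \<in> smooth_fns"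
    and D: "has_partials f fx fy"
    by (elim bexE)
  have D': "((\<lambda>z. of_real (f z) :: complex) has_derivative (\<lambda>h. of_real (Re h * fx z + Im h * fy z))) (at z)" for z
    by (rule bounded_linear.has_derivative[OF bounded_linear_of_real has_partialsD[OF D]])
  have "partial_x (\<lambda>z. of_real (f z) :: complex) = (\<lambda>z. of_real (fx z))"
    "partial_y (\<lambda>z. of_real (f z) :: complex) = (\<lambda>z. of_real (fy z))"
    by (auto simp: fun_eq_iff partial_x_has_derivative[OF D'] partial_y_has_derivative[OF D'])
  moreover have "(\<lambda>z. of_real (f z) :: complex) differentiable_on \<Omega>"
    using D' by (intro differentiable_at_imp_differentiable_on) (auto simp: differentiable_def)
  ultimately show ?case
    using Suc.IH[OF S(1)] Suc.IH[OF S(2)] by simp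
qed

section \<open>Cutoff functions and admissible test functions\<close>

definition cutoff :: "complex \<Rightarrow> real \<Rightarrow> complex \<Rightarrow> real" where
  "cutoff z0 s z = bump 1 (s\<^sup>2 - (cmod (z - z0))\<^sup>2)"

text \<open>The derivative t^(-2) exp (-1/t) of the radial profile in the variable t = s^2 - |z -
  z0|^2, not a derivative in z. The gradient of \<open>cutoff\<close> is -2 \<open>cutoff'\<close>
  (z - z0). Squared distances keep both functions smooth at the centre.\<close>

definition cutoff' :: "complex \<Rightarrow> real \<Rightarrow> complex \<Rightarrow> real" where
  "cutoff' z0 s z = bump [:0, 0, 1:] (s\<^sup>2 - (cmod (z - z0))\<^sup>2)"

lemma smooth_fns_cmod: "(\<lambda>z. (cmod (z - w))\<^sup>2) \<in> smooth_fns"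
proof -
  have "(\<lambda>z. (Re z + - Re w) * (Re z + - Re w) + (Im z + - Im w) * (Im z + - Im w)) \<in> smooth_fns"
    by (intro smooth_fns.intros)
  then show ?thesis unfolding cmod_power2 by (simp add: power2_eq_square)
qed

lemma smooth_fns_cutoff: "cutoff z0 s \<in> smooth_fns"
proof -
  have "(\<lambda>z. bump 1 (s\<^sup>2 + (-1) * (cmod (z - z0))\<^sup>2)) \<in> smooth_fns"
    by (intro smooth_fns.intros smooth_fns_cmod)
  then show ?thesis by (simp add: cutoff_def[abs_def])
qed

lemma cutoff_eq_0: "s > 0 \<Longrightarrow> z \<notin> ball z0 s \<Longrightarrow> cutoff z0 s z = 0"
  and cutoff'_eq_0: "s > 0 \<Longrightarrow> z \<notin> ball z0 s \<Longrightarrow> cutoff' z0 s z = 0"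
  using power2_less_imp_less[of "cmod (z0 - z)" s]
  by (auto simp: cutoff_def cutoff'_def bump_def dist_norm norm_minus_commute[of z])

lemma has_derivative_cutoff:
  "(cutoff z0 s has_derivative (\<lambda>h. - 2 * cutoff' z0 s z * inner (z - z0) h)) (at z)"
proof -
  have "((\<lambda>z. bump 1 (s\<^sup>2 - (cmod (z - z0))\<^sup>2)) has_derivative
      (\<lambda>h. (- 2 * inner (z - z0) h) * bump ([:0, 0, 1:] * (1 - pderiv 1)) (s\<^sup>2 - (cmod (z - z0))\<^sup>2))) (at z)"
    by (rule DERIV_compose_FDERIV[OF DERIV_bump])
       (auto intro!: derivative_eq_intros simp: power2_norm_eq_inner inner_commute)
  then show ?thesis
    by (simp add: cutoff_def[abs_def] cutoff'_def mult_ac pderiv_1)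
qed

definition test_fn :: "complex \<Rightarrow> real \<Rightarrow> complex \<Rightarrow> real \<Rightarrow> complex \<Rightarrow> bicomplex" where
  "test_fn z0 s \<zeta> e z = (cutoff z0 s z / ((cmod (z - \<zeta>))\<^sup>2 + e)) *\<^sub>R jc (cnj (z - \<zeta>))"

lemma cutoff_mult_test_functions:
  assumes "s > 0" "cball z0 s \<subseteq> \<Omega>" "f \<in> smooth_fns"
  shows "(\<lambda>z. of_real (cutoff z0 s z * f z)) \<in> test_functions \<Omega>"
  unfolding test_functions_def
proof (intro CollectI conjI allI)
  show "Ck_on n \<Omega> (\<lambda>z. of_real (cutoff z0 s z * f z))" for n
    by (intro Ck_on_smooth_fns smooth_fns.mult smooth_fns_cutoff assms)
  have "\<forall>z\<in>\<Omega> - cball z0 s. complex_of_real (cutoff z0 s z * f z) = 0"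
    using cutoff_eq_0[OF \<open>s > 0\<close>] by (auto simp: dist_norm)
  then show "\<exists>K. compact K \<and> K \<subseteq> \<Omega> \<and> (\<forall>z\<in>\<Omega> - K. complex_of_real (cutoff z0 s z * f z) = 0)"
    using assms(2) compact_cball by metis
qed

lemma Sc_scaleR_jc: "Sc (r *\<^sub>R jc w) = of_real (r * Re w)"
  and Vec_scaleR_jc: "Vec (r *\<^sub>R jc w) = of_real (r * Im w)"
  by (simp_all add: complex_eq_iff)

lemma test_fn_test_functions:
  assumes "s > 0" "e > 0" "cball z0 s \<subseteq> \<Omega>"
  shows "test_fn z0 s \<zeta> e \<in> bc_space (test_functions \<Omega>)"
proof -
  let ?q = "\<lambda>z. inverse ((cmod (z - \<zeta>))\<^sup>2 + e)"
  have inv: "?q \<in> smooth_fns"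
    by (intro smooth_fns.inverse smooth_fns.add smooth_fns_cmod smooth_fns.const add_nonneg_pos assms) simp
  have "(\<lambda>z. of_real (cutoff z0 s z * (?q z * (Re z + - Re \<zeta>)))) \<in> test_functions \<Omega>"
    "(\<lambda>z. of_real (cutoff z0 s z * (?q z * ((-1) * Im z + Im \<zeta>)))) \<in> test_functions \<Omega>"
    by (intro cutoff_mult_test_functions assms smooth_fns.mult smooth_fns.add smooth_fns.const
        smooth_fns.Re smooth_fns.Im inv)+
  moreover have "(\<lambda>z. Sc (test_fn z0 s \<zeta> e z)) = (\<lambda>z. of_real (cutoff z0 s z * (?q z * (Re z + - Re \<zeta>))))"
    "(\<lambda>z. Vec (test_fn z0 s \<zeta> e z)) = (\<lambda>z. of_real (cutoff z0 s z * (?q z * ((-1) * Im z + Im \<zeta>))))"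
    by (simp_all only: fun_eq_iff test_fn_def Sc_scaleR_jc Vec_scaleR_jc divide_inverse) (simp_all add: mult.assoc)
  ultimately show ?thesis
    by (simp only: bc_space_def mem_Collect_eq)
qed

text \<open>Put w = z - \<zeta> and q = |w|^2 + e. The d-bar derivative of \<open>jc (cnj w)\<close>
  is 1, that of |w|^2 is \<open>jc w\<close>, and \<open>jc w * jc (cnj w)\<close> is |w|^2, so the
  kernel contributes 1/q - |w|^2/q^2 = e/q^2. The cutoff contributes its own d-bar derivative
  -\<open>cutoff'\<close> \<open>jc (z - z0)\<close>.\<close>

lemma dbar_test_fn:
  assumes "e > 0"
  shows "dbar (test_fn z0 s \<zeta> e) z =
     (cutoff z0 s z * (e / ((cmod (z - \<zeta>))\<^sup>2 + e)\<^sup>2)) *\<^sub>R 1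
     - cutoff' z0 s z *\<^sub>R (jc (z - z0) * jc (cnj (z - \<zeta>) /\<^sub>R ((cmod (z - \<zeta>))\<^sup>2 + e)))"
proof -
  define q where "q = (cmod (z - \<zeta>))\<^sup>2 + e"
  have q: "q > 0" using assms by (simp add: q_def add_nonneg_pos)
  define A where "A = cutoff z0 s z"
  define B where "B = cutoff' z0 s z"
  define x0 y0 x y where "x0 = Re (z - z0)" "y0 = Im (z - z0)" "x = Re (z - \<zeta>)" "y = Im (z - \<zeta>)"
  let ?f' = "\<lambda>h. (A / q) *\<^sub>R jc (cnj h) +
      ((- 2 * B * inner (z - z0) h * q - A * (2 * inner (z - \<zeta>) h)) / (q * q)) *\<^sub>R jc (cnj (z - \<zeta>))"
  have Dq: "((\<lambda>z. (cmod (z - \<zeta>))\<^sup>2 + e) has_derivative (\<lambda>h. 2 * inner (z - \<zeta>) h)) (at z)"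
    by (auto intro!: derivative_eq_intros simp: power2_norm_eq_inner inner_commute)
  have Dj: "((\<lambda>z. jc (cnj (z - \<zeta>))) has_derivative (\<lambda>h. jc (cnj h))) (at z)"
    by (rule bounded_linear.has_derivative[OF bounded_linear_jc]) (auto intro!: derivative_eq_intros)
  have D: "(test_fn z0 s \<zeta> e has_derivative ?f') (at z)"
    unfolding test_fn_def[abs_def]
    by (rule has_derivative_eq_rhs[OF has_derivative_scaleR[OF
          has_derivative_divide'[OF has_derivative_cutoff Dq] Dj]])
       (use q in \<open>simp_all add: q_def A_def B_def\<close>)
  have "dbar (test_fn z0 s \<zeta> e) z = (1/2) *\<^sub>R (?f' 1 + bj * ?f' \<i>)"
    by (simp only: dbar_def partial_x_has_derivative[OF D] partial_y_has_derivative[OF D])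
  also have "\<dots> = (A * (e / q\<^sup>2)) *\<^sub>R 1 - B *\<^sub>R (jc (z - z0) * jc (cnj (z - \<zeta>) /\<^sub>R q))"
  proof -
    \<comment> \<open>Eliminating e and passing to real coordinates leaves a rational identity in x,
      y, x0, y0, A, B and q.\<close>
    have e: "e = q - (x\<^sup>2 + y\<^sup>2)"
      by (simp add: q_def cmod_power2 x0_y0_x_y_def)
    have inner: "inner (z - z0) 1 = x0" "inner (z - z0) \<i> = y0" "inner (z - \<zeta>) 1 = x" "inner (z - \<zeta>) \<i> = y"
      by (simp_all add: inner_complex_def x0_y0_x_y_def)
    have zz: "z - z0 = Complex x0 y0" "z - \<zeta> = Complex x y"
      by (simp_all add: complex_eq_iff x0_y0_x_y_def)
    show ?thesis
      unfolding inner unfolding zz e using q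
      apply (simp add: bicomplex_eq_iff complex_eq_iff bj_def)
      apply (simp add: field_simps power2_eq_square)
      done
  qed
  finally show ?thesis by (simp add: q_def A_def B_def)
qed

section \<open>Weakly singular integrals in the plane\<close>

lemma cball_sets_borel [measurable]: "cball (a :: complex) r \<in> sets borel"
  by simp

text \<open>A discrete form of integration in polar coordinates: a disc of radius r k and height c k
  contributes a multiple of c k (r k)^2.\<close>

lemma nn_integral_cball_series_finite:
  fixes f :: "complex \<Rightarrow> ennreal" and c r :: "nat \<Rightarrow> real"
  assumes le: "\<And>w. f w \<le> (\<Sum>k. ennreal (c k) * indicator (cball 0 (r k)) w)"
    and c: "\<And>k. c k \<ge> 0" and r: "\<And>k. r k \<ge> 0" and s: "summable (\<lambda>k. c k * (r k)\<^sup>2)"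
  shows "(\<integral>\<^sup>+w. f w \<partial>lborel) < \<infinity>"
proof -
  have "(\<integral>\<^sup>+w. f w \<partial>lborel) \<le> (\<integral>\<^sup>+(w::complex). (\<Sum>k. ennreal (c k) * indicator (cball 0 (r k)) w) \<partial>lborel)"
    by (rule nn_integral_mono) (rule le)
  also have "\<dots> = (\<Sum>k. \<integral>\<^sup>+(w::complex). ennreal (c k) * indicator (cball 0 (r k)) w \<partial>lborel)"
    by (rule nn_integral_suminf) measurable
  also have "\<dots> = (\<Sum>k. ennreal (unit_ball_vol 2 * (c k * (r k)\<^sup>2)))"
  proof (rule suminf_cong)
    fix k
    have "(\<integral>\<^sup>+w. ennreal (c k) * indicator (cball (0::complex) (r k)) w \<partial>lborel) =
        ennreal (c k) * ennreal (unit_ball_vol 2 * (r k)\<^sup>2)"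
      using emeasure_cball[of "r k" "0::complex"] r by (subst nn_integral_cmult_indicator) auto
    also have "\<dots> = ennreal (c k * (unit_ball_vol 2 * (r k)\<^sup>2))"
      using c by (subst ennreal_mult') auto
    finally show "(\<integral>\<^sup>+w. ennreal (c k) * indicator (cball (0::complex) (r k)) w \<partial>lborel) =
        ennreal (unit_ball_vol 2 * (c k * (r k)\<^sup>2))"
      by (simp only: mult.left_commute)
  qed
  also have "\<dots> < \<infinity>"
  proof -
    have "unit_ball_vol 2 * (c k * (r k)\<^sup>2) \<ge> 0" for k
      using c by simp
    from ennreal_suminf_neq_top[OF summable_mult[OF s] this] show ?thesis
      unfolding infinity_ennreal_def less_top[symmetric] .
  qed
  finally show ?thesis .
qed

lemma ennreal_le_suminf: "f n \<le> (\<Sum>k. f k)" for f :: "nat \<Rightarrow> ennreal"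
  using sum_le_suminf[of f "{n}"] by simp

text \<open>The kernel |w|^(-3/2), with value 0 at the origin by division by zero. The exponent is
  below 2, hence integrable near 0, and makes \<open>sing\<close> the cube of |w|^(-1/2), so that
  the products of kernels that occur are dominated through u v^2 <= u^3 + v^3.\<close>

definition sing :: "complex \<Rightarrow> real" where
  "sing w = 1 / (cmod w * sqrt (cmod w))"

lemma sing_nonneg [simp]: "sing w \<ge> 0"
  by (simp add: sing_def)

lemma borel_measurable_sing [measurable]: "sing \<in> borel_measurable borel"
  unfolding sing_def[abs_def] by measurable

lemma sing_minus_commute: "sing (x - y) = sing (y - x)"
  by (simp add: sing_def norm_minus_commute)

text \<open>The radii 4^(-n) have the exact square roots 2^(-n), so \<open>sing\<close> is at most 8
  * 8^n on the annulus 4^(-n-1) < |w| <= 4^(-n). The areas decay like 16^(-n), and the resulting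
  series is geometric with ratio 1/2.\<close>

lemma nn_integral_sing_cball: "(\<integral>\<^sup>+w. ennreal (sing w) * indicator (cball 0 1) w \<partial>lborel) < \<infinity>"
proof (rule nn_integral_cball_series_finite)
  fix w :: complex
  let ?c = "\<lambda>k. 8 * 8 ^ k :: real" and ?r = "\<lambda>k. (1/4) ^ k :: real"
  show "ennreal (sing w) * indicator (cball 0 1) w \<le>
      (\<Sum>k. ennreal (?c k) * indicator (cball 0 (?r k)) w)"
  proof (cases "w = 0 \<or> cmod w > 1")
    case True
    then have "ennreal (sing w) * indicator (cball 0 1) w = 0" by (auto simp: sing_def)
    then show ?thesis by (simp only: zero_le)
  next
    case False
    define k where "k = (LEAST k. ?r k < cmod w)"
    have ex: "\<exists>k. ?r k < cmod w"
      using False by (intro real_arch_pow_inv) auto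
    then have k: "?r k < cmod w" unfolding k_def by (rule LeastI_ex)
    \<comment> \<open>As |w| <= 1 = (1/4)^0, the least index k is positive; its predecessor n fails
      the inequality, which puts w in the disc of radius (1/4)^n.\<close>
    with False have "k \<noteq> 0" by (auto intro: Nat.gr0I)
    then obtain n where n: "k = Suc n" by (cases k) auto
    then have "\<not> ?r n < cmod w"
      using not_less_Least[of n "\<lambda>k. ?r k < cmod w"] by (simp add: k_def)
    then have w: "w \<in> cball 0 (?r n)" by simp
    have sqrt: "(1/2) ^ k = sqrt (?r k)"
    proof (rule real_sqrt_unique[symmetric])
      have "((1/2) ^ k)\<^sup>2 = (1/2 * (1/2) :: real) ^ k"
        by (simp only: power_mult_distrib power2_eq_square)
      then show "((1/2) ^ k)\<^sup>2 = ?r k" by simp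
    qed simp
    have "(1/2) ^ k \<le> sqrt (cmod w)"
      unfolding sqrt by (rule real_sqrt_le_mono[OF less_imp_le[OF k]])
    then have "?r k * (1/2) ^ k \<le> cmod w * sqrt (cmod w)"
      using k by (intro mult_mono) auto
    then have "(1/4 * (1/2)) ^ k \<le> cmod w * sqrt (cmod w)"
      by (simp only: power_mult_distrib)
    then have "(1/8) ^ k \<le> cmod w * sqrt (cmod w)"
      by simp
    then have "sing w \<le> 1 / (1/8) ^ k"
      unfolding sing_def by (intro divide_left_mono) (use False in auto)
    also have "\<dots> = ?c n" by (simp add: n power_divide)
    finally have "ennreal (sing w) * indicator (cball 0 1) w \<le> ennreal (?c n) * indicator (cball 0 (?r n)) w"
      using w by (auto simp: indicator_def intro: ennreal_leI)
    also have "\<dots> \<le> (\<Sum>k. ennreal (?c k) * indicator (cball 0 (?r k)) w)"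
      by (rule ennreal_le_suminf)
    finally show ?thesis .
  qed
  have "?c k * (?r k)\<^sup>2 = 8 * (8 * (1/4 * (1/4))) ^ k" for k
    by (simp only: power_mult_distrib power2_eq_square mult.assoc)
  moreover have "summable (\<lambda>k. 8 * (8 * (1/4 * (1/4))) ^ k :: real)"
    by (intro summable_mult summable_geometric) simp
  ultimately show "summable (\<lambda>k. ?c k * (?r k)\<^sup>2)"
    by (simp only:)
qed auto

text \<open>Now the discs grow: for 2^(k-1) <= |w| < 2^k the kernel is at most 16^(-(k-1)), whence
  the height 16 * 16^(-k). Against areas of order 4^k the series is geometric with ratio
  1/4.\<close>

lemma integrable_poisson_kernel:
  "integrable lborel (\<lambda>w::complex. 1 / ((cmod w)\<^sup>2 + 1)\<^sup>2)"
proof (rule integrableI_nonneg)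
  let ?c = "\<lambda>k. 16 * (1/16) ^ k :: real" and ?r = "\<lambda>k. 2 ^ k :: real"
  show "(\<integral>\<^sup>+w. ennreal (1 / ((cmod w)\<^sup>2 + 1)\<^sup>2) \<partial>lborel) < \<infinity>"
  proof (rule nn_integral_cball_series_finite)
    fix w :: complex
    define k where "k = (LEAST k. cmod w < ?r k)"
    have "\<exists>k. cmod w < ?r k" by (rule real_arch_pow) auto
    then have k: "cmod w < ?r k" unfolding k_def by (rule LeastI_ex)
    have "1 / ((cmod w)\<^sup>2 + 1)\<^sup>2 \<le> ?c k"
    proof (cases k)
      case 0
      have "1 / ((cmod w)\<^sup>2 + 1)\<^sup>2 \<le> 1 / 1"
        by (intro divide_left_mono) (auto intro: one_le_power simp: add_nonneg_eq_0_iff)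
      then show ?thesis by (simp add: 0)
    next
      case (Suc n)
      then have "\<not> cmod w < ?r n"
        using not_less_Least[of n "\<lambda>k. cmod w < ?r k"] by (simp add: k_def)
      then have "(?r n)\<^sup>2 \<le> (cmod w)\<^sup>2 + 1"
        using power_mono[of "?r n" "cmod w" 2] by (simp add: not_less add_increasing2)
      then have "((?r n)\<^sup>2)\<^sup>2 \<le> ((cmod w)\<^sup>2 + 1)\<^sup>2"
        by (rule power_mono) simp
      moreover have "((?r n)\<^sup>2)\<^sup>2 = 16 ^ n"
        by (simp add: power2_eq_square flip: power_mult_distrib)
      ultimately have "1 / ((cmod w)\<^sup>2 + 1)\<^sup>2 \<le> 1 / 16 ^ n"
        by (intro divide_left_mono mult_pos_pos zero_less_power add_nonneg_pos) auto
      then show ?thesis by (simp add: Suc power_one_over)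
    qed
    then have "ennreal (1 / ((cmod w)\<^sup>2 + 1)\<^sup>2) \<le> ennreal (?c k) * indicator (cball 0 (?r k)) w"
      using k by (auto simp: indicator_def intro: ennreal_leI)
    also have "\<dots> \<le> (\<Sum>k. ennreal (?c k) * indicator (cball 0 (?r k)) w)"
      by (rule ennreal_le_suminf)
    finally show "ennreal (1 / ((cmod w)\<^sup>2 + 1)\<^sup>2) \<le> (\<Sum>k. ennreal (?c k) * indicator (cball 0 (?r k)) w)" .
  next
    have "?c k * (?r k)\<^sup>2 = 16 * (1/16 * (2 * 2)) ^ k" for k
      by (simp only: power_mult_distrib power2_eq_square mult.assoc)
    moreover have "summable (\<lambda>k. 16 * (1/16 * (2 * 2)) ^ k :: real)"
      by (intro summable_mult summable_geometric) simp
    ultimately show "summable (\<lambda>k. ?c k * (?r k)\<^sup>2)"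
      by (simp only:)
  qed auto
qed auto

lemma lborel_distr_diff: "distr lborel borel (\<lambda>x. z - x) = (lborel :: complex measure)"
  using lborel_affine[of "-1" z] by (simp add: density_1)

lemma nn_integral_lborel_diff:
  fixes f :: "complex \<Rightarrow> ennreal"
  assumes [measurable]: "f \<in> borel_measurable borel"
  shows "(\<integral>\<^sup>+x. f (z - x) \<partial>lborel) = (\<integral>\<^sup>+x. f x \<partial>lborel)"
  by (subst (2) lborel_distr_diff[symmetric, of z]) (simp add: nn_integral_distr)

text \<open>Split at |z - x| = 1. The near part is a translate of one fixed integral, hence
  independent of z; in the far part \<open>sing\<close> is at most 1 and the measure of B bounds the
  integral.\<close>

lemma sing_bound:
  fixes B :: "complex set"
  assumes [measurable]: "B \<in> sets borel" and "bounded B"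
  obtains C where "C > 0" "\<And>z. (\<integral>\<^sup>+x. ennreal (sing (z - x)) * indicator B x \<partial>lborel) \<le> ennreal C"
proof -
  define g :: "complex \<Rightarrow> ennreal" where "g w = ennreal (sing w) * indicator (cball 0 1) w" for w
  have g [measurable]: "g \<in> borel_measurable borel"
    unfolding g_def[abs_def] by measurable
  define K where "K = integral\<^sup>N lborel g"
  have fin: "K + emeasure lborel B < \<infinity>"
    using nn_integral_sing_cball emeasure_bounded_finite[OF \<open>bounded B\<close>] by (simp add: K_def g_def[abs_def])
  define C where "C = enn2real (K + emeasure lborel B) + 1"
  have "(\<integral>\<^sup>+x. ennreal (sing (z - x)) * indicator B x \<partial>lborel) \<le> ennreal C" for z
  proof -
    have *: "sing w \<le> 1" if "\<not> cmod w \<le> 1" for w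
    proof -
      have "1 * 1 \<le> cmod w * sqrt (cmod w)" using that by (intro mult_mono) auto
      then show ?thesis using that by (simp add: sing_def)
    qed
    have "(\<integral>\<^sup>+x. ennreal (sing (z - x)) * indicator B x \<partial>lborel) \<le>
        (\<integral>\<^sup>+x. g (z - x) + indicator B x \<partial>lborel)"
      by (intro nn_integral_mono) (auto simp: g_def indicator_def intro: *)
    also have "\<dots> = K + emeasure lborel B"
      using nn_integral_lborel_diff[OF g, of z]
      by (subst nn_integral_add) (simp_all add: K_def)
    also have "\<dots> \<le> ennreal C"
    proof -
      have "K + emeasure lborel B = ennreal (enn2real (K + emeasure lborel B))"
        using fin by (intro ennreal_enn2real[symmetric]) (simp only: infinity_ennreal_def)
      also have "\<dots> \<le> ennreal C"
        by (rule ennreal_leI) (simp add: C_def)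
      finally show ?thesis .
    qed
    finally show ?thesis .
  qed
  moreover have "C > 0" by (simp add: C_def add_nonneg_pos)
  ultimately show ?thesis using that by blast
qed

section \<open>Elementary inequalities between kernels\<close>

lemma mult_le_sum_cubes:
  fixes u v :: real
  assumes "u \<ge> 0" "v \<ge> 0"
  shows "u * v\<^sup>2 \<le> u ^ 3 + v ^ 3"
proof (cases "u \<le> v")
  case True
  then have "u * v\<^sup>2 \<le> v * v\<^sup>2" by (intro mult_right_mono) auto
  then show ?thesis using assms by (simp add: power3_eq_cube power2_eq_square add_increasing)
next
  case False
  then have "u * v\<^sup>2 \<le> u * u\<^sup>2" using assms by (intro mult_left_mono power_mono) auto
  then show ?thesis using assms by (simp add: power3_eq_cube power2_eq_square add_increasing2)
qed

lemma sing_eq_cube: "sing w = (1 / sqrt (cmod w)) ^ 3"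
  by (cases "w = 0") (auto simp: sing_def power3_eq_cube)

lemma inverse_cmod_eq_square: "1 / cmod w = (1 / sqrt (cmod w))\<^sup>2"
  by (simp add: power_divide)

lemma kernel1_le: "1 / cmod w \<le> 1 + sing w"
  using mult_le_sum_cubes[of 1 "1 / sqrt (cmod w)"]
  by (simp add: sing_eq_cube inverse_cmod_eq_square)

lemma kernel_half_le: "1 / sqrt (cmod v) * (1 / cmod w) \<le> sing v + sing w"
  unfolding sing_eq_cube inverse_cmod_eq_square by (rule mult_le_sum_cubes) auto

text \<open>Multiplying by sqrt |v + w| <= sqrt |v| + sqrt |w| lowers one of the two exponents to
  1/2, and each resulting term has the form u v^2 of the cube inequality. In the application v = x -
  z and w = z - y, so the gained factor |v + w|^(-1/2) does not depend on the variable of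
  integration.\<close>

lemma kernel2_le:
  assumes "v + w \<noteq> 0"
  shows "1 / cmod v * (1 / cmod w) \<le> 2 * (sing v + sing w) / sqrt (cmod (v + w))"
proof (cases "v = 0 \<or> w = 0")
  case True
  then show ?thesis by (auto simp: divide_nonneg_nonneg)
next
  case False
  define a b where "a = sqrt (cmod v)" "b = sqrt (cmod w)"
  have ab: "a > 0" "b > 0" "cmod v = a\<^sup>2" "cmod w = b\<^sup>2" using False by (simp_all add: a_b_def)
  have "sqrt (cmod (v + w)) \<le> sqrt (cmod v + cmod w)" by (simp add: norm_triangle_ineq)
  also have "\<dots> \<le> a + b" unfolding a_b_def by (rule sqrt_add_le_add_sqrt) auto
  finally have "1 / cmod v * (1 / cmod w) * sqrt (cmod (v + w)) \<le> 1 / cmod v * (1 / cmod w) * (a + b)"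
    by (rule mult_left_mono) auto
  also have "\<dots> = (1 / b) * (1 / a)\<^sup>2 + (1 / a) * (1 / b)\<^sup>2"
    using ab by (simp add: field_simps power2_eq_square)
  also have "\<dots> \<le> ((1 / b) ^ 3 + (1 / a) ^ 3) + ((1 / a) ^ 3 + (1 / b) ^ 3)"
    using ab by (intro add_mono mult_le_sum_cubes) auto
  also have "\<dots> = 2 * (sing v + sing w)"
    by (simp add: sing_eq_cube a_b_def)
  finally show ?thesis using assms by (simp add: pos_le_divide_eq)
qed

lemma nn_integral_kernel_le:
  fixes B :: "complex set"
  assumes [measurable]: "B \<in> sets borel"
    and C: "\<And>z. (\<integral>\<^sup>+x. ennreal (sing (z - x)) * indicator B x \<partial>lborel) \<le> ennreal C" and "C > 0"
    and f: "\<And>z. f z \<le> c * (sing (x - z) + sing (y - z))" and "c \<ge> 0"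
  shows "(\<integral>\<^sup>+z. ennreal (f z) * indicator B z \<partial>lborel) \<le> ennreal (2 * c * C)"
proof -
  have "(\<integral>\<^sup>+z. ennreal (f z) * indicator B z \<partial>lborel) \<le>
      (\<integral>\<^sup>+z. ennreal c * (ennreal (sing (x - z)) * indicator B z + ennreal (sing (y - z)) * indicator B z) \<partial>lborel)"
    using f \<open>c \<ge> 0\<close>
    by (intro nn_integral_mono)
       (auto simp: indicator_def ennreal_mult[symmetric] ennreal_plus[symmetric] simp del: ennreal_plus intro!: ennreal_leI)
  also have "\<dots> \<le> ennreal c * (ennreal C + ennreal C)"
    by (subst nn_integral_cmult, measurable, subst nn_integral_add, measurable)
       (intro mult_left_mono add_mono C; simp)
  also have "\<dots> = ennreal (2 * c * C)"
    using assms by (simp add: ennreal_mult[symmetric] ennreal_plus[symmetric] algebra_simps del: ennreal_plus)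
  finally show ?thesis .
qed

text \<open>One constant, uniform in x and y, for all kernel integrals used later: the single
  kernel, two kernels composed, and one kernel composed with the power -1/2 left by that
  composition.\<close>

lemma kernel_bounds:
  fixes B :: "complex set"
  assumes B: "B \<in> sets borel" "bounded B"
  obtains C where "C > 0"
    "\<And>x. (\<integral>\<^sup>+z. ennreal (1 / cmod (x - z)) * indicator B z \<partial>lborel) \<le> ennreal C"
    "\<And>x y. x \<noteq> y \<Longrightarrow> (\<integral>\<^sup>+z. ennreal (1 / cmod (x - z) * (1 / cmod (z - y))) * indicator B z \<partial>lborel)
        \<le> ennreal (C / sqrt (cmod (x - y)))"
    "\<And>x y. (\<integral>\<^sup>+z. ennreal (1 / cmod (x - z) * (1 / sqrt (cmod (z - y)))) * indicator B z \<partial>lborel) \<le> ennreal C"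
proof -
  note [measurable] = B(1)
  obtain D where D: "D > 0" "\<And>z. (\<integral>\<^sup>+x. ennreal (sing (z - x)) * indicator B x \<partial>lborel) \<le> ennreal D"
    using sing_bound[OF B] by metis
  define m where "m = measure lborel B"
  have m: "emeasure lborel B = ennreal m" "m \<ge> 0"
    using emeasure_bounded_finite[OF B(2)] by (simp_all add: m_def emeasure_eq_ennreal_measure)
  \<comment> \<open>The first bound uses m + D, from 1/|w| <= 1 + \<open>sing w\<close>. In the
    second, 4 is the 2 of \<open>kernel2_le\<close> times 2 for the two singular points; the third
    needs only 2 D.\<close>
  define C where "C = m + 4 * D"
  note bound = nn_integral_kernel_le[OF B(1) D(2) D(1)]
  show ?thesis
  proof
    show "C > 0" using m D by (simp add: C_def)
    show "(\<integral>\<^sup>+z. ennreal (1 / cmod (x - z)) * indicator B z \<partial>lborel) \<le> ennreal C" for x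
    proof -
      have "(\<integral>\<^sup>+z. ennreal (1 / cmod (x - z)) * indicator B z \<partial>lborel) \<le>
        (\<integral>\<^sup>+z. indicator B z + ennreal (sing (x - z)) * indicator B z \<partial>lborel)"
        using ennreal_leI[OF kernel1_le] by (intro nn_integral_mono) (simp add: indicator_def)
      also have "\<dots> \<le> ennreal m + ennreal D"
        using D m by (subst nn_integral_add) auto
      also have "\<dots> \<le> ennreal C"
        using D m by (simp add: C_def ennreal_plus[symmetric] del: ennreal_plus)
      finally show ?thesis .
    qed
    show "(\<integral>\<^sup>+z. ennreal (1 / cmod (x - z) * (1 / cmod (z - y))) * indicator B z \<partial>lborel)
        \<le> ennreal (C / sqrt (cmod (x - y)))" if "x \<noteq> y" for x y
    proof -
      have "(\<integral>\<^sup>+z. ennreal (1 / cmod (x - z) * (1 / cmod (z - y))) * indicator B z \<partial>lborel)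
          \<le> ennreal (2 * (2 / sqrt (cmod (x - y))) * D)"
        using that kernel2_le[of "x - z" "z - y" for z] by (intro bound) (auto simp: sing_minus_commute[of _ y])
      also have "\<dots> \<le> ennreal (C / sqrt (cmod (x - y)))"
        using m D by (intro ennreal_leI) (simp add: C_def divide_right_mono)
      finally show ?thesis .
    qed
    show "(\<integral>\<^sup>+z. ennreal (1 / cmod (x - z) * (1 / sqrt (cmod (z - y)))) * indicator B z \<partial>lborel) \<le> ennreal C" for x y
    proof -
      have "(\<integral>\<^sup>+z. ennreal (1 / cmod (x - z) * (1 / sqrt (cmod (z - y)))) * indicator B z \<partial>lborel)
          \<le> ennreal (2 * 1 * D)"
        using kernel_half_le[of "z - y" "x - z" for z]
        by (intro bound) (auto simp: sing_minus_commute[of _ y] mult.commute add.commute)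
      also have "\<dots> \<le> ennreal C"
        using m D by (intro ennreal_leI) (simp add: C_def)
      finally show ?thesis .
    qed
  qed
qed

section \<open>The representation formula\<close>

text \<open>All values lie in the range of \<open>jc\<close>, so the norm is multiplicative in every
  product with this kernel. At w = 0 the value is 0 for each e, including e = 0.\<close>

definition kern :: "real \<Rightarrow> complex \<Rightarrow> bicomplex" where
  "kern e w = jc (cnj w /\<^sub>R ((cmod w)\<^sup>2 + e))"

lemma kern_0: "kern 0 w = jc (inverse w)"
proof -
  have "cnj w /\<^sub>R (cmod w)\<^sup>2 = inverse w"
    by (cases "w = 0")
       (auto simp: complex_norm_square scaleR_conv_of_real field_simps simp flip: of_real_power)
  then show ?thesis by (simp add: kern_def)
qed

lemma borel_measurable_kern [measurable]: "kern e \<in> borel_measurable borel"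
proof -
  have [measurable]: "cnj \<in> borel_measurable borel"
    by (intro borel_measurable_continuous_onI continuous_intros)
  show ?thesis unfolding kern_def[abs_def] by measurable
qed

lemma norm_kern_0: "norm (kern 0 w) = 1 / cmod w"
  by (simp add: kern_0 norm_inverse divide_inverse)

lemma norm_kern_le: "e \<ge> 0 \<Longrightarrow> norm (kern e w) \<le> 1 / cmod w"
proof (cases "w = 0")
  case False
  assume "e \<ge> 0"
  then have "(cmod w)\<^sup>2 > 0" "(cmod w)\<^sup>2 + e > 0" using False by (auto simp: add_pos_nonneg)
  moreover have "cmod w * cmod w \<le> (cmod w)\<^sup>2 + e" using \<open>e \<ge> 0\<close> by (simp add: power2_eq_square)
  ultimately show ?thesis using False by (simp add: kern_def divide_inverse[symmetric] field_simps)
qed (simp add: kern_def)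

lemma norm_mult_kern: "norm (W * kern e w) = norm W * norm (kern e w)"
  by (simp add: kern_def norm_mult_jc)

lemma kern_tendsto: "((\<lambda>n. kern (e n) w) \<longlongrightarrow> kern 0 w) F" if "(e \<longlongrightarrow> 0) F"
proof (cases "w = 0")
  case False
  have "((\<lambda>n. cnj w /\<^sub>R ((cmod w)\<^sup>2 + e n)) \<longlongrightarrow> cnj w /\<^sub>R ((cmod w)\<^sup>2 + 0)) F"
    using False by (intro tendsto_intros that) auto
  then show ?thesis
    unfolding kern_def by (intro bounded_linear.tendsto[OF bounded_linear_jc])
qed (simp add: kern_def)

lemma ennreal_indicator_mult: "ennreal (indicator B x * c) = ennreal c * indicator B x"
  by (simp add: indicator_def)

text \<open>Tonelli with the integration in \<zeta> done before that in z: the integral of h in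
  \<zeta> is bounded uniformly in z, which leaves a multiple of the norm of F.\<close>

lemma integrable_pairI:
  fixes F :: "complex \<Rightarrow> bicomplex" and P :: "complex \<Rightarrow> complex \<Rightarrow> bicomplex"
    and h :: "complex \<Rightarrow> complex \<Rightarrow> real"
  assumes F: "integrable lborel F"
    and P [measurable]: "case_prod P \<in> borel_measurable (lborel \<Otimes>\<^sub>M lborel)"
    and h [measurable]: "case_prod h \<in> borel_measurable (lborel \<Otimes>\<^sub>M lborel)"
    and C: "\<And>z. (\<integral>\<^sup>+\<zeta>. ennreal (h z \<zeta>) \<partial>lborel) \<le> ennreal C"
    and le: "\<And>z \<zeta>. norm (P z \<zeta>) \<le> norm (F z) * h z \<zeta>"
  shows "integrable (lborel \<Otimes>\<^sub>M lborel) (case_prod P)"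
proof (rule integrableI_bounded[OF P])
  note [measurable] = borel_measurable_integrable[OF F]
  have "(\<integral>\<^sup>+x. ennreal (norm (case_prod P x)) \<partial>(lborel \<Otimes>\<^sub>M lborel)) =
      (\<integral>\<^sup>+z. (\<integral>\<^sup>+\<zeta>. ennreal (norm (P z \<zeta>)) \<partial>lborel) \<partial>lborel)"
    by (subst lborel.nn_integral_fst[symmetric]) auto
  also have "\<dots> \<le> (\<integral>\<^sup>+z. (\<integral>\<^sup>+\<zeta>. ennreal (norm (F z)) * ennreal (h z \<zeta>) \<partial>lborel) \<partial>lborel)"
    by (intro nn_integral_mono) (auto simp: ennreal_mult'[symmetric] intro!: ennreal_leI le)
  also have "\<dots> \<le> (\<integral>\<^sup>+z. ennreal (norm (F z)) * ennreal C \<partial>lborel)"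
  proof (rule nn_integral_mono)
    fix z :: complex
    have "(\<integral>\<^sup>+\<zeta>. ennreal (norm (F z)) * ennreal (h z \<zeta>) \<partial>lborel) =
        ennreal (norm (F z)) * (\<integral>\<^sup>+\<zeta>. ennreal (h z \<zeta>) \<partial>lborel)"
      by (rule nn_integral_cmult) measurable
    also have "\<dots> \<le> ennreal (norm (F z)) * ennreal C" by (intro mult_left_mono C) simp
    finally show "(\<integral>\<^sup>+\<zeta>. ennreal (norm (F z)) * ennreal (h z \<zeta>) \<partial>lborel) \<le> ennreal (norm (F z)) * ennreal C" .
  qed
  also have "\<dots> = (\<integral>\<^sup>+z. ennreal (norm (F z)) \<partial>lborel) * ennreal C"
    by (rule nn_integral_multc) measurable
  also have "\<dots> < \<infinity>"
    using F by (simp add: integrable_iff_bounded ennreal_mult_less_top)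
  finally show "(\<integral>\<^sup>+x. ennreal (norm (case_prod P x)) \<partial>(lborel \<Otimes>\<^sub>M lborel)) < \<infinity>" .
qed

section \<open>The approximate identity and its limit\<close>

definition poisson :: "complex \<Rightarrow> real" where
  "poisson w = 1 / ((cmod w)\<^sup>2 + 1)\<^sup>2"

text \<open>The value is pi, but the argument only divides by this number, so its positivity is
  enough.\<close>

definition poisson_mass :: real where
  "poisson_mass = (LINT w|lborel. poisson w)"

lemma poisson_pos: "poisson w > 0"
proof -
  have "(cmod w)\<^sup>2 + 1 > 0" by (simp add: add_nonneg_pos)
  then show ?thesis by (simp add: poisson_def)
qed

lemma integrable_poisson: "integrable lborel poisson"
  using integrable_poisson_kernel by (simp add: poisson_def[abs_def])

lemma borel_measurable_poisson [measurable]: "poisson \<in> borel_measurable borel"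
  using borel_measurable_integrable[OF integrable_poisson] by simp

lemma poisson_mass_pos: "poisson_mass > 0"
proof -
  have "poisson_mass \<noteq> 0"
  proof
    assume "poisson_mass = 0"
    then have "AE w in lborel. poisson w = 0"
      unfolding poisson_mass_def
      using integral_nonneg_eq_0_iff_AE[OF integrable_poisson] poisson_pos less_imp_le by auto
    then have "AE w::complex in lborel. False"
      using poisson_pos by (auto elim!: eventually_mono simp: less_le)
    then show False by (simp add: eventually_False ae_filter_eq_bot_iff)
  qed
  moreover have "poisson_mass \<ge> 0"
    unfolding poisson_mass_def by (intro integral_nonneg_AE) (simp add: poisson_pos less_imp_le)
  ultimately show ?thesis by simp
qed

lemma integral_lborel_affine_complex:
  fixes f :: "complex \<Rightarrow> real"
  assumes [measurable]: "f \<in> borel_measurable borel" and "e > 0"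
  shows "(LINT \<zeta>|lborel. f \<zeta>) = (LINT w|lborel. e\<^sup>2 * f (z - e *\<^sub>R w))"
proof -
  have "(LINT \<zeta>|lborel. f \<zeta>) =
      (LINT \<zeta>|density (distr lborel borel (\<lambda>w. z + (- e) *\<^sub>R w)) (\<lambda>_. ennreal (e\<^sup>2)). f \<zeta>)"
    using lborel_affine[of "- e" z] \<open>e > 0\<close> by simp
  also have "\<dots> = (LINT w|lborel. e\<^sup>2 * f (z - e *\<^sub>R w))"
    by (subst integral_density) (auto simp: integral_distr)
  finally show ?thesis .
qed

text \<open>This is why the regularization parameter becomes e^2 from here on: with it, the kernel
  is the dilation of \<open>poisson\<close> by the length e, and the factor e^2 in front is the
  Jacobian in the plane.\<close>

lemma poisson_scale:
  assumes "e > 0"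
  shows "e\<^sup>2 * (e\<^sup>2 / ((cmod (e *\<^sub>R w))\<^sup>2 + e\<^sup>2)\<^sup>2) = poisson w"
proof -
  have "(cmod (e *\<^sub>R w))\<^sup>2 + e\<^sup>2 = e\<^sup>2 * ((cmod w)\<^sup>2 + 1)"
    by (simp add: power_mult_distrib algebra_simps)
  then show ?thesis using assms by (simp add: poisson_def power_mult_distrib power2_eq_square)
qed

text \<open>Substituting \<zeta> = z - e w turns the integral into that of
  \<open>indicator B (z - e w) * poisson w\<close>. Off the frontier, z has a neighbourhood on which
  the indicator is constant, so the integrand converges pointwise, with \<open>poisson\<close> as
  majorant.\<close>

lemma poisson_approx_indicator:
  fixes B :: "complex set"
  assumes [measurable]: "B \<in> sets borel" and "z \<notin> frontier B"
    and e: "\<And>n. e n > 0" "e \<longlonglongrightarrow> 0"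
  shows "(\<lambda>n. LINT \<zeta>|lborel. indicator B \<zeta> * ((e n)\<^sup>2 / ((cmod (z - \<zeta>))\<^sup>2 + (e n)\<^sup>2)\<^sup>2))
            \<longlonglongrightarrow> poisson_mass * indicator B z" (is "?I \<longlonglongrightarrow> _")
    and "\<bar>LINT \<zeta>|lborel. indicator B \<zeta> * ((e n)\<^sup>2 / ((cmod (z - \<zeta>))\<^sup>2 + (e n)\<^sup>2)\<^sup>2)\<bar> \<le> poisson_mass"
proof -
  have eq: "?I n = (LINT w|lborel. indicator B (z - e n *\<^sub>R w) * poisson w)" for n
  proof -
    have "?I n = (LINT w|lborel. (e n)\<^sup>2 * (indicator B (z - e n *\<^sub>R w) *
       ((e n)\<^sup>2 / ((cmod (z - (z - e n *\<^sub>R w)))\<^sup>2 + (e n)\<^sup>2)\<^sup>2)))"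
      by (rule integral_lborel_affine_complex[OF _ e(1)]) measurable
    also have "\<dots> = (LINT w|lborel. indicator B (z - e n *\<^sub>R w) * poisson w)"
    proof (intro Bochner_Integration.integral_cong refl)
      fix w
      have "z - (z - e n *\<^sub>R w) = e n *\<^sub>R w" by simp
      then show "(e n)\<^sup>2 * (indicator B (z - e n *\<^sub>R w) *
          ((e n)\<^sup>2 / ((cmod (z - (z - e n *\<^sub>R w)))\<^sup>2 + (e n)\<^sup>2)\<^sup>2)) = indicator B (z - e n *\<^sub>R w) * poisson w"
        by (simp only: mult.left_commute[of "(e n)\<^sup>2" "indicator B (z - e n *\<^sub>R w)"] poisson_scale[OF e(1)])
    qed
    finally show ?thesis .
  qed
  have ev: "\<forall>\<^sub>F y in nhds z. (indicator B y :: real) = indicator B z"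
  proof (cases "z \<in> B")
    case True
    then have "z \<in> interior B" using \<open>z \<notin> frontier B\<close> closure_subset by (auto simp: frontier_def)
    then show ?thesis
      using True by (intro eventually_nhds[THEN iffD2] exI[of _ "interior B"])
         (auto simp: indicator_def dest: interior_subset[THEN subsetD])
  next
    case False
    then have "z \<in> - closure B" using \<open>z \<notin> frontier B\<close> interior_subset by (auto simp: frontier_def)
    then show ?thesis
      using False by (intro eventually_nhds[THEN iffD2] exI[of _ "- closure B"])
         (auto simp: indicator_def dest: closure_subset[THEN subsetD])
  qed
  have "(\<lambda>n. LINT w|lborel. indicator B (z - e n *\<^sub>R w) * poisson w) \<longlonglongrightarrow> (LINT w|lborel. indicator B z * poisson w)"
  proof (rule integral_dominated_convergence[where w = poisson])
    show "AE w in lborel. (\<lambda>n. indicator B (z - e n *\<^sub>R w) * poisson w) \<longlonglongrightarrow> indicator B z * poisson w"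
    proof (rule AE_I2)
      fix w :: complex
      have "(\<lambda>n. z - e n *\<^sub>R w) \<longlonglongrightarrow> z - 0 *\<^sub>R w" by (intro tendsto_intros e)
      then have "(\<lambda>n. z - e n *\<^sub>R w) \<longlonglongrightarrow> z" by simp
      from eventually_compose_filterlim[OF ev this]
      have "\<forall>\<^sub>F n in sequentially. (indicator B (z - e n *\<^sub>R w) :: real) = indicator B z" .
      then show "(\<lambda>n. indicator B (z - e n *\<^sub>R w) * poisson w) \<longlonglongrightarrow> indicator B z * poisson w"
        by (intro tendsto_eventually) (auto elim: eventually_mono)
    qed
    show "AE w in lborel. norm (indicator B (z - e n *\<^sub>R w) * poisson w) \<le> poisson w" for n
      using poisson_pos[THEN less_imp_le] by (intro AE_I2) (auto simp: indicator_def)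
  qed (auto intro: integrable_poisson)
  then show "?I \<longlonglongrightarrow> poisson_mass * indicator B z"
    unfolding eq by (simp add: poisson_mass_def mult.commute)
  have "\<bar>?I n\<bar> \<le> (LINT w|lborel. poisson w)"
    unfolding eq real_norm_def[symmetric]
  proof (rule Bochner_Integration.integral_norm_bound_integral)
    show le: "norm (indicator B (z - e n *\<^sub>R w) * poisson w) \<le> poisson w" for w
      using poisson_pos[THEN less_imp_le] by (auto simp: indicator_def)
    show "integrable lborel (\<lambda>w. indicator B (z - e n *\<^sub>R w) * poisson w)"
      by (rule Bochner_Integration.integrable_bound[OF integrable_poisson])
         (use poisson_pos[THEN less_imp_le] in \<open>auto simp: indicator_def\<close>)
  qed (rule integrable_poisson)
  then show "\<bar>?I n\<bar> \<le> poisson_mass" by (simp add: poisson_mass_def)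
qed

text \<open>F is only integrable, so the singular integral may diverge at individual \<zeta>.
  Averaging over the bounded set B makes the double integral absolutely convergent, and the
  integrand for e = 0 dominates all the regularized ones.\<close>

lemma kernel_regularization_limit:
  fixes F :: "complex \<Rightarrow> bicomplex" and B :: "complex set"
  assumes F: "integrable lborel F" and B: "B \<in> sets borel" "bounded B"
    and e: "\<And>n. e n > 0" "e \<longlonglongrightarrow> 0"
  shows "integrable lborel (\<lambda>\<zeta>. indicator B \<zeta> *\<^sub>R (LINT z|lborel. F z * kern 0 (z - \<zeta>)))" (is ?int)
    and "(\<lambda>n. LINT \<zeta>|lborel. indicator B \<zeta> *\<^sub>R (LINT z|lborel. F z * kern ((e n)\<^sup>2) (z - \<zeta>)))
           \<longlonglongrightarrow> (LINT \<zeta>|lborel. indicator B \<zeta> *\<^sub>R (LINT z|lborel. F z * kern 0 (z - \<zeta>)))" (is ?lim)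
proof -
  note [measurable] = B(1) borel_measurable_integrable[OF F]
  obtain C where C: "\<And>z. (\<integral>\<^sup>+\<zeta>. ennreal (1 / cmod (z - \<zeta>)) * indicator B \<zeta> \<partial>lborel) \<le> ennreal C"
    using kernel_bounds[OF B] by metis
  define P where "P d z \<zeta> = indicator B \<zeta> *\<^sub>R (F z * kern d (z - \<zeta>))" for d z \<zeta>
  have P [measurable]: "case_prod (P d) \<in> borel_measurable (lborel \<Otimes>\<^sub>M lborel)" for d
    unfolding P_def[abs_def] by measurable
  have bound: "norm (P d z \<zeta>) \<le> norm (F z) * (indicator B \<zeta> * (1 / cmod (z - \<zeta>)))" if "d \<ge> 0" for d z \<zeta>
    using mult_left_mono[OF norm_kern_le[OF that, of "z - \<zeta>"], of "norm (F z)"]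
    by (auto simp: P_def norm_mult_kern indicator_def)
  have int: "integrable (lborel \<Otimes>\<^sub>M lborel) (case_prod (P d))" if "d \<ge> 0" for d
  proof (rule integrable_pairI[OF F P _ _ bound[OF that]])
    show "(\<integral>\<^sup>+\<zeta>. ennreal (indicator B \<zeta> * (1 / cmod (z - \<zeta>))) \<partial>lborel) \<le> ennreal C" for z
      unfolding ennreal_indicator_mult by (rule C)
  qed measurable
  have inner: "(LINT z|lborel. P d z \<zeta>) = indicator B \<zeta> *\<^sub>R (LINT z|lborel. F z * kern d (z - \<zeta>))" for d \<zeta>
    by (simp add: P_def)
  have outer: "(LINT \<zeta>|lborel. indicator B \<zeta> *\<^sub>R (LINT z|lborel. F z * kern d (z - \<zeta>))) =
      integral\<^sup>L (lborel \<Otimes>\<^sub>M lborel) (case_prod (P d))" if "d \<ge> 0" for d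
    using lborel_pair.integral_snd[OF int[OF that]] by (simp add: inner)
  show ?int
    using lborel_pair.integrable_snd[OF int[of 0]] by (simp add: inner)
  have "(\<lambda>n. integral\<^sup>L (lborel \<Otimes>\<^sub>M lborel) (case_prod (P ((e n)\<^sup>2)))) \<longlonglongrightarrow>
      integral\<^sup>L (lborel \<Otimes>\<^sub>M lborel) (case_prod (P 0))"
  proof (rule integral_dominated_convergence[where w = "\<lambda>x. norm (case_prod (P 0) x)"])
    have "(\<lambda>n. (e n)\<^sup>2) \<longlonglongrightarrow> 0\<^sup>2" by (intro tendsto_intros e)
    then have e2: "(\<lambda>n. (e n)\<^sup>2) \<longlonglongrightarrow> 0" by simp
    have "(\<lambda>n. P ((e n)\<^sup>2) z \<zeta>) \<longlonglongrightarrow> P 0 z \<zeta>" for z \<zeta>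
      unfolding P_def
      by (intro tendsto_intros bounded_bilinear.tendsto[OF bounded_bilinear_bicomplex_mult] kern_tendsto e2)
    then show "AE x in lborel \<Otimes>\<^sub>M lborel. (\<lambda>n. case_prod (P ((e n)\<^sup>2)) x) \<longlonglongrightarrow> case_prod (P 0) x"
      by (intro AE_I2) auto
    have "norm (P ((e n)\<^sup>2) z \<zeta>) \<le> norm (P 0 z \<zeta>)" for n z \<zeta>
      using mult_left_mono[OF norm_kern_le[of "(e n)\<^sup>2" "z - \<zeta>"], of "norm (F z)"]
      by (simp add: P_def norm_mult_kern norm_kern_0 indicator_def)
    then show "AE x in lborel \<Otimes>\<^sub>M lborel. norm (case_prod (P ((e n)\<^sup>2)) x) \<le> norm (case_prod (P 0) x)" for n
      by (intro AE_I2) auto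
  qed (use int[of 0] in auto)
  then show ?lim by (simp add: outer)
qed

text \<open>Fubini moves the approximate identity from G to the indicator of B. Its action there is
  known off the frontier, a null set, so no regularity of G is called for.\<close>

lemma poisson_regularization_limit:
  fixes G :: "complex \<Rightarrow> bicomplex" and B :: "complex set"
  assumes G: "integrable lborel G" and B: "B \<in> sets borel" "bounded B" "frontier B \<in> null_sets lborel"
    and e: "\<And>n. e n > 0" "e \<longlonglongrightarrow> 0"
  shows "(\<lambda>n. LINT \<zeta>|lborel. indicator B \<zeta> *\<^sub>R
              (LINT z|lborel. ((e n)\<^sup>2 / ((cmod (z - \<zeta>))\<^sup>2 + (e n)\<^sup>2)\<^sup>2) *\<^sub>R G z))
           \<longlonglongrightarrow> (LINT \<zeta>|lborel. indicator B \<zeta> *\<^sub>R (poisson_mass *\<^sub>R G \<zeta>))"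
proof -
  note [measurable] = B(1) borel_measurable_integrable[OF G]
  define \<rho> where "\<rho> d w = d\<^sup>2 / ((cmod w)\<^sup>2 + d\<^sup>2)\<^sup>2" for d and w :: complex
  have \<rho> [measurable]: "\<rho> d \<in> borel_measurable borel" for d
    unfolding \<rho>_def[abs_def] by measurable
  have \<rho>_bounds: "0 \<le> \<rho> d w" "\<rho> d w \<le> 1 / d\<^sup>2" if "d > 0" for d w
  proof -
    have "d\<^sup>2 * d\<^sup>2 \<le> ((cmod w)\<^sup>2 + d\<^sup>2)\<^sup>2"
      unfolding power2_eq_square[of "(cmod w)\<^sup>2 + d\<^sup>2"] by (intro mult_mono) auto
    moreover have "(cmod w)\<^sup>2 + d\<^sup>2 > 0" using that by (simp add: add_nonneg_pos)
    ultimately show "0 \<le> \<rho> d w" "\<rho> d w \<le> 1 / d\<^sup>2"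
      using that by (simp_all add: \<rho>_def field_simps)
  qed
  define Q where "Q d z \<zeta> = (indicator B \<zeta> * \<rho> d (z - \<zeta>)) *\<^sub>R G z" for d z \<zeta>
  have Q [measurable]: "case_prod (Q d) \<in> borel_measurable (lborel \<Otimes>\<^sub>M lborel)" for d
    unfolding Q_def[abs_def] by measurable
  have int: "integrable (lborel \<Otimes>\<^sub>M lborel) (case_prod (Q d))" if "d > 0" for d
  proof (rule integrable_pairI[OF G Q])
    show "norm (Q d z \<zeta>) \<le> norm (G z) * (indicator B \<zeta> * (1 / d\<^sup>2))" for z \<zeta>
      using mult_left_mono[OF \<rho>_bounds(2)[OF that, of "z - \<zeta>"], of "norm (G z)"] \<rho>_bounds(1)[OF that]
      by (auto simp: Q_def indicator_def mult.commute)
    show "(\<integral>\<^sup>+\<zeta>. ennreal (indicator B \<zeta> * (1 / d\<^sup>2)) \<partial>lborel) \<le> ennreal (1 / d\<^sup>2 * measure lborel B)" for z :: complex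
      unfolding ennreal_indicator_mult using emeasure_bounded_finite[OF B(2)]
      by (subst nn_integral_cmult_indicator)
         (auto simp: emeasure_eq_ennreal_measure ennreal_mult''[symmetric])
  qed measurable
  have lhs: "(LINT \<zeta>|lborel. indicator B \<zeta> *\<^sub>R (LINT z|lborel. \<rho> d (z - \<zeta>) *\<^sub>R G z)) =
      (LINT z|lborel. (LINT \<zeta>|lborel. indicator B \<zeta> * \<rho> d (z - \<zeta>)) *\<^sub>R G z)" if "d > 0" for d
  proof -
    have "(LINT \<zeta>|lborel. (LINT z|lborel. Q d z \<zeta>)) = (LINT z|lborel. (LINT \<zeta>|lborel. Q d z \<zeta>))"
      by (rule lborel_pair.Fubini_integral[OF int[OF that]])
    moreover have "(LINT z|lborel. Q d z \<zeta>) = indicator B \<zeta> *\<^sub>R (LINT z|lborel. \<rho> d (z - \<zeta>) *\<^sub>R G z)" for \<zeta>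
      by (simp add: Q_def flip: scaleR_scaleR)
    moreover have "(LINT \<zeta>|lborel. Q d z \<zeta>) = (LINT \<zeta>|lborel. indicator B \<zeta> * \<rho> d (z - \<zeta>)) *\<^sub>R G z" for z
      unfolding Q_def
    proof (intro integral_scaleR_left)
      have "integrable lborel (\<lambda>\<zeta>. 1 / d\<^sup>2 * indicator B \<zeta> :: real)"
        using emeasure_bounded_finite[OF B(2)] by (intro integrable_mult_right integrable_real_indicator) auto
      then show "integrable lborel (\<lambda>\<zeta>. indicator B \<zeta> * \<rho> d (z - \<zeta>))"
        by (rule Bochner_Integration.integrable_bound)
           (use \<rho>_bounds[OF that] in \<open>auto simp: indicator_def\<close>)
    qed
    ultimately show ?thesis by simp
  qed
  note approx = poisson_approx_indicator[OF B(1) _ e, folded \<rho>_def]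
  have "(\<lambda>n. LINT z|lborel. (LINT \<zeta>|lborel. indicator B \<zeta> * \<rho> (e n) (z - \<zeta>)) *\<^sub>R G z) \<longlonglongrightarrow>
      (LINT z|lborel. (poisson_mass * indicator B z) *\<^sub>R G z)"
  proof (rule integral_dominated_convergence[where w = "\<lambda>z. poisson_mass * norm (G z)"])
    have AE: "AE z in lborel. z \<notin> frontier B"
      by (rule AE_not_in[OF B(3)])
    show "AE z in lborel. (\<lambda>n. (LINT \<zeta>|lborel. indicator B \<zeta> * \<rho> (e n) (z - \<zeta>)) *\<^sub>R G z) \<longlonglongrightarrow>
        (poisson_mass * indicator B z) *\<^sub>R G z"
      using AE by eventually_elim (intro tendsto_intros approx)
    show "AE z in lborel. norm ((LINT \<zeta>|lborel. indicator B \<zeta> * \<rho> (e n) (z - \<zeta>)) *\<^sub>R G z) \<le> poisson_mass * norm (G z)" for n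
      using AE by eventually_elim (simp add: approx mult_right_mono)
    show "integrable lborel (\<lambda>z. poisson_mass * norm (G z))" using G by simp
  qed measurable
  then show ?thesis
    by (simp add: lhs[OF e(1), unfolded \<rho>_def] \<rho>_def mult.commute)
qed

text \<open>Lebesgue differentiation: outside a negligible set, f x is the limit of averages over
  cubes with corner x, and all these averages vanish.\<close>

lemma AE_zero_if_cbox_integrals_zero:
  fixes f :: "complex \<Rightarrow> bicomplex"
  assumes int: "\<And>a b. integrable lborel (\<lambda>x. indicator (cbox a b) x *\<^sub>R f x)"
    and zero: "\<And>a b. (LINT x|lborel. indicator (cbox a b) x *\<^sub>R f x) = 0"
  shows "AE x in lborel. f x = 0"
proof -
  have set_int: "set_integrable lborel (cbox a b) f" for a b
    using int by (simp add: set_integrable_def)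
  have eq: "integral (cbox a b) f = 0" "f integrable_on cbox a b" for a b
    using set_borel_integral_eq_integral[OF set_int, of a b] zero by (auto simp: set_lebesgue_integral_def)
  from integrable_ccontinuous_explicit[of f, OF eq(2)]
  obtain N where N: "negligible N" "\<And>x e. x \<notin> N \<Longrightarrow> 0 < e \<Longrightarrow>
      \<exists>d>0. \<forall>h. 0 < h \<and> h < d \<longrightarrow> norm (integral (cbox x (x + h *\<^sub>R One)) f /\<^sub>R h ^ DIM(complex) - f x) < e"
    by blast
  have "f x = 0" if x: "x \<notin> N" for x
  proof (rule ccontr)
    assume "f x \<noteq> 0"
    then obtain d where d: "d > 0"
      "\<And>h. 0 < h \<and> h < d \<Longrightarrow> norm (integral (cbox x (x + h *\<^sub>R One)) f /\<^sub>R h ^ DIM(complex) - f x) < norm (f x)"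
      using N(2)[OF x, of "norm (f x)"] by auto
    from d(2)[of "d / 2"] d(1) show False by (simp add: eq)
  qed
  moreover have "AE x in lebesgue. x \<notin> N"
    using N(1) by (intro AE_not_in) (simp add: negligible_iff_null_sets)
  ultimately have "AE x in lebesgue. f x = 0" by (auto elim: eventually_mono)
  then show ?thesis by (simp add: AE_completion_iff)
qed

lemma regularized_representation:
  fixes F G :: "complex \<Rightarrow> bicomplex"
  assumes F: "integrable lborel F" and G: "integrable lborel G"
    and eq: "\<And>\<zeta> e. e > 0 \<Longrightarrow> (LINT z|lborel. (e / ((cmod (z - \<zeta>))\<^sup>2 + e)\<^sup>2) *\<^sub>R G z) =
              - (LINT z|lborel. F z * kern e (z - \<zeta>))"
  shows "AE \<zeta> in lborel. poisson_mass *\<^sub>R G \<zeta> = - (LINT z|lborel. F z * kern 0 (z - \<zeta>))"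
proof -
  let ?H = "\<lambda>\<zeta>. LINT z|lborel. F z * kern 0 (z - \<zeta>)"
  define e :: "nat \<Rightarrow> real" where "e n = inverse (real (Suc n))" for n
  have e: "\<And>n. e n > 0" "e \<longlonglongrightarrow> 0"
    using LIMSEQ_inverse_real_of_nat by (auto simp: e_def[abs_def])
  have "AE \<zeta> in lborel. poisson_mass *\<^sub>R G \<zeta> + ?H \<zeta> = 0"
  proof (rule AE_zero_if_cbox_integrals_zero)
    fix a b :: complex
    let ?B = "cbox a b"
    have B: "?B \<in> sets borel" "bounded ?B" by auto
    have null: "frontier ?B \<in> null_sets lborel"
      using negligible_convex_frontier[of ?B]
      by (simp add: negligible_iff_null_sets null_sets_completion_iff)
    have 1: "integrable lborel (\<lambda>\<zeta>. indicator ?B \<zeta> *\<^sub>R (poisson_mass *\<^sub>R G \<zeta>))"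
      using G by (intro integrable_mult_indicator) auto
    note 2 = kernel_regularization_limit[OF F B e]
    show "integrable lborel (\<lambda>\<zeta>. indicator ?B \<zeta> *\<^sub>R (poisson_mass *\<^sub>R G \<zeta> + ?H \<zeta>))"
      using 1 2(1) by (simp add: scaleR_add_right)
    \<comment> \<open>The assumed identity, at parameter (e n)^2, rewrites this sequence as minus
      the kernel sequence, so the two limits over the box must agree.\<close>
    from poisson_regularization_limit[OF G B null e]
    have "(\<lambda>n. - (LINT \<zeta>|lborel. indicator ?B \<zeta> *\<^sub>R (LINT z|lborel. F z * kern ((e n)\<^sup>2) (z - \<zeta>))))
        \<longlonglongrightarrow> (LINT \<zeta>|lborel. indicator ?B \<zeta> *\<^sub>R (poisson_mass *\<^sub>R G \<zeta>))"
      using e(1) by (simp add: eq less_imp_neq[symmetric])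
    from LIMSEQ_unique[OF this tendsto_minus[OF 2(2)]]
    show "(LINT \<zeta>|lborel. indicator ?B \<zeta> *\<^sub>R (poisson_mass *\<^sub>R G \<zeta> + ?H \<zeta>)) = 0"
      using 1 2(1) by (simp add: scaleR_add_right)
  qed
  then show ?thesis by eventually_elim (simp add: eq_neg_iff_add_eq_0)
qed

section \<open>Interior estimates\<close>

text \<open>The weak d-bar derivative of the product of cutoff and W when V is that of W, because
  the cutoff has d-bar derivative -\<open>cutoff'\<close> \<open>jc (z - z0)\<close>.\<close>

definition cutoff_rhs :: "complex \<Rightarrow> real \<Rightarrow> (complex \<Rightarrow> bicomplex) \<Rightarrow> (complex \<Rightarrow> bicomplex) \<Rightarrow> complex \<Rightarrow> bicomplex" where
  "cutoff_rhs z0 s W V z = cutoff z0 s z *\<^sub>R V z - cutoff' z0 s z *\<^sub>R (W z * jc (z - z0))"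

text \<open>All that the interior estimates use of a solution. W and V live on the whole plane and
  are integrated against Lebesgue-Borel measure; the coefficients survive only through M; and the
  equation survives only as its tests with the regularized kernels, for every cutoff radius up to
  R.\<close>

definition local_sol :: "real \<Rightarrow> complex \<Rightarrow> real \<Rightarrow> (complex \<Rightarrow> bicomplex) \<Rightarrow> (complex \<Rightarrow> bicomplex) \<Rightarrow> bool" where
  "local_sol M z0 R W V \<longleftrightarrow> integrable lborel W \<and> V \<in> borel_measurable borel \<and>
     (\<forall>z. norm (V z) \<le> M * norm (W z)) \<and>
     (\<forall>s \<zeta> e. 0 < s \<longrightarrow> s \<le> R \<longrightarrow> 0 < e \<longrightarrow>
        (LINT z|lborel. (e / ((cmod (z - \<zeta>))\<^sup>2 + e)\<^sup>2) *\<^sub>R (cutoff z0 s z *\<^sub>R W z)) =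
        - (LINT z|lborel. cutoff_rhs z0 s W V z * kern e (z - \<zeta>)))"

lemma cutoff_bounds: "0 \<le> cutoff z0 s z" "cutoff z0 s z \<le> 1" "0 \<le> cutoff' z0 s z" "cutoff' z0 s z \<le> 2"
proof -
  show "0 \<le> cutoff z0 s z" "cutoff z0 s z \<le> 1" "0 \<le> cutoff' z0 s z"
    by (auto simp: cutoff_def cutoff'_def bump_def)
  \<comment> \<open>Uses exp u >= 1 + u + u^2/2, with u = 1/t.\<close>
  have *: "u\<^sup>2 * exp (- u) \<le> 2" if "u \<ge> 0" for u :: real
    using exp_lower_Taylor_quadratic[OF that] that by (simp add: exp_minus field_simps)
  have "bump [:0, 0, 1:] t \<le> 2" for t
    using *[of "1 / t"] by (auto simp: bump_def power2_eq_square)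
  then show "cutoff' z0 s z \<le> 2" by (simp add: cutoff'_def)
qed

lemma cutoff_lower:
  assumes "0 < t" "t < s" "z \<in> ball z0 t"
  shows "exp (- (1 / (s\<^sup>2 - t\<^sup>2))) \<le> cutoff z0 s z"
proof -
  have "cmod (z - z0) < t" using assms by (simp add: dist_norm norm_minus_commute)
  then have *: "(cmod (z - z0))\<^sup>2 \<le> t\<^sup>2" by (intro power_mono) auto
  have **: "t\<^sup>2 < s\<^sup>2" using assms by (intro power_strict_mono) auto
  have "1 / (s\<^sup>2 - (cmod (z - z0))\<^sup>2) \<le> 1 / (s\<^sup>2 - t\<^sup>2)"
    using * ** by (intro divide_left_mono mult_pos_pos) auto
  then show ?thesis using * ** by (simp add: cutoff_def bump_def)
qed

lemma isCont_cutoff: "isCont (cutoff z0 s) z"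
  by (rule has_derivative_continuous[OF has_derivative_cutoff])

lemma borel_measurable_cutoff [measurable]: "cutoff z0 s \<in> borel_measurable borel"
  by (intro borel_measurable_continuous_onI continuous_at_imp_continuous_on ballI isCont_cutoff)

lemma borel_measurable_cutoff' [measurable]: "cutoff' z0 s \<in> borel_measurable borel"
proof -
  have "isCont (bump P) t" for P t
    by (rule DERIV_isCont[OF DERIV_bump])
  then have [measurable]: "bump P \<in> borel_measurable borel" for P
    by (intro borel_measurable_continuous_onI continuous_at_imp_continuous_on ballI)
  show ?thesis unfolding cutoff'_def[abs_def] by measurable
qed

lemma ball_sets_borel [measurable]: "ball (a :: complex) r \<in> sets borel"
  by simp

context
  fixes M z0 R W V
  assumes sol: "local_sol M z0 R W V" and M: "M \<ge> 0"
begin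

lemma local_sol_integrable: "integrable lborel W"
  using sol by (simp add: local_sol_def)

lemma local_sol_measurable [measurable]: "W \<in> borel_measurable borel" "V \<in> borel_measurable borel"
  using sol borel_measurable_integrable[of lborel W] by (simp_all add: local_sol_def)

lemma cutoff_rhs_measurable [measurable]: "cutoff_rhs z0 s W V \<in> borel_measurable borel"
  unfolding cutoff_rhs_def[abs_def] by measurable

text \<open>M comes from the term with V; 2 s is the bound 2 for \<open>cutoff'\<close> times |z -
  z0| <= s.\<close>

lemma norm_cutoff_rhs_le:
  assumes "s > 0"
  shows "norm (cutoff_rhs z0 s W V z) \<le> (M + 2 * s) * norm (W z) * indicator (ball z0 s) z"
proof (cases "z \<in> ball z0 s")
  case False
  then show ?thesis
    using cutoff_eq_0[OF assms] cutoff'_eq_0[OF assms] by (simp add: cutoff_rhs_def)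
next
  case True
  have V: "norm (V z) \<le> M * norm (W z)" using sol by (simp add: local_sol_def)
  have z: "cmod (z - z0) \<le> s" using True by (simp add: dist_norm norm_minus_commute)
  have "norm (cutoff_rhs z0 s W V z) \<le> cutoff z0 s z * norm (V z) + cutoff' z0 s z * (norm (W z) * cmod (z - z0))"
    unfolding cutoff_rhs_def using cutoff_bounds[of z0 s z]
    by (intro order_trans[OF norm_triangle_ineq4]) (simp add: norm_mult_jc)
  also have "\<dots> \<le> 1 * (M * norm (W z)) + 2 * (norm (W z) * s)"
    using cutoff_bounds[of z0 s z] V z assms by (intro add_mono mult_mono) auto
  finally show ?thesis using True by (simp add: algebra_simps)
qed

lemma cutoff_rhs_integrable: "s > 0 \<Longrightarrow> integrable lborel (cutoff_rhs z0 s W V)"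
proof (rule Bochner_Integration.integrable_bound)
  assume s: "s > 0"
  show "integrable lborel (\<lambda>z. (M + 2 * s) * norm (W z))"
    using local_sol_integrable by simp
  have "norm (cutoff_rhs z0 s W V z) \<le> (M + 2 * s) * norm (W z)" for z
    using norm_cutoff_rhs_le[OF s, of z] M s by (auto simp: indicator_def split: if_splits intro: order_trans)
  then show "AE z in lborel. norm (cutoff_rhs z0 s W V z) \<le> norm ((M + 2 * s) * norm (W z))"
    using M s by simp
qed measurable

lemma local_sol_representation:
  assumes "0 < s" "s \<le> R"
  shows "AE \<zeta> in lborel. poisson_mass *\<^sub>R (cutoff z0 s \<zeta> *\<^sub>R W \<zeta>) =
           - (LINT z|lborel. cutoff_rhs z0 s W V z * kern 0 (z - \<zeta>))"
proof (rule regularized_representation)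
  show "integrable lborel (\<lambda>z. cutoff z0 s z *\<^sub>R W z)"
    by (rule Bochner_Integration.integrable_bound[OF local_sol_integrable])
       (use cutoff_bounds in \<open>auto simp: mult_left_le_one_le\<close>)
  show "(LINT z|lborel. (e / ((cmod (z - \<zeta>))\<^sup>2 + e)\<^sup>2) *\<^sub>R (cutoff z0 s z *\<^sub>R W z)) =
      - (LINT z|lborel. cutoff_rhs z0 s W V z * kern e (z - \<zeta>))" if "e > 0" for \<zeta> e
    using sol assms that by (simp add: local_sol_def)
qed (rule cutoff_rhs_integrable[OF assms(1)])

text \<open>The representation formula divided by the cutoff, whose lower bound on the smaller ball
  gives the exponential in c. The right-hand side is an extended nonnegative integral and may be
  infinite at this stage, which makes the bound ready for iteration.\<close>

lemma local_sol_pointwise: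
  assumes "0 < t" "t < s" "s \<le> R"
  defines "c \<equiv> (M + 2 * s) / (poisson_mass * exp (- (1 / (s\<^sup>2 - t\<^sup>2))))"
  shows "AE \<zeta> in lborel. \<zeta> \<in> ball z0 t \<longrightarrow> ennreal (norm (W \<zeta>)) \<le>
           ennreal c * (\<integral>\<^sup>+z. ennreal (1 / cmod (\<zeta> - z)) * indicator (ball z0 s) z * ennreal (norm (W z)) \<partial>lborel)"
proof -
  have "0 < s" using assms by simp
  let ?k = "poisson_mass * exp (- (1 / (s\<^sup>2 - t\<^sup>2)))"
  have k: "?k > 0" using poisson_mass_pos by simp
  from local_sol_representation[OF \<open>0 < s\<close> \<open>s \<le> R\<close>] show ?thesis
  proof (eventually_elim, intro impI)
    fix \<zeta>
    let ?U = "LINT z|lborel. cutoff_rhs z0 s W V z * kern 0 (z - \<zeta>)"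
    assume eq: "poisson_mass *\<^sub>R (cutoff z0 s \<zeta> *\<^sub>R W \<zeta>) = - ?U" and \<zeta>: "\<zeta> \<in> ball z0 t"
    let ?I = "\<integral>\<^sup>+z. ennreal (1 / cmod (\<zeta> - z)) * indicator (ball z0 s) z * ennreal (norm (W z)) \<partial>lborel"
    have "?k * norm (W \<zeta>) \<le> poisson_mass * cutoff z0 s \<zeta> * norm (W \<zeta>)"
      using cutoff_lower[OF assms(1,2) \<zeta>] poisson_mass_pos by (intro mult_right_mono mult_left_mono) auto
    also have "\<dots> = norm ?U"
      using arg_cong[OF eq, of norm] cutoff_bounds(1)[of z0 s \<zeta>] poisson_mass_pos by simp
    finally have "ennreal (?k * norm (W \<zeta>)) \<le> ennreal (norm ?U)" by (rule ennreal_leI)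
    also have "\<dots> \<le> (\<integral>\<^sup>+z. ennreal (norm (cutoff_rhs z0 s W V z * kern 0 (z - \<zeta>))) \<partial>lborel)"
      \<comment> \<open>If the singular integrand is not integrable, its Bochner integral is 0 by
        convention and the bound is trivial.\<close>
      by (cases "integrable lborel (\<lambda>z. cutoff_rhs z0 s W V z * kern 0 (z - \<zeta>))")
         (auto simp: not_integrable_integral_eq intro: integral_norm_bound_ennreal)
    also have "\<dots> \<le> (\<integral>\<^sup>+z. ennreal (M + 2 * s) * (ennreal (1 / cmod (\<zeta> - z)) * indicator (ball z0 s) z * ennreal (norm (W z))) \<partial>lborel)"
    proof (rule nn_integral_mono)
      fix z
      have "norm (cutoff_rhs z0 s W V z * kern 0 (z - \<zeta>)) \<le>
          ((M + 2 * s) * norm (W z) * indicator (ball z0 s) z) * (1 / cmod (\<zeta> - z))"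
        unfolding norm_mult_kern norm_kern_0 norm_minus_commute[of z]
        by (intro mult_right_mono norm_cutoff_rhs_le \<open>0 < s\<close>) simp
      also have "\<dots> = (M + 2 * s) * (1 / cmod (\<zeta> - z) * indicator (ball z0 s) z * norm (W z))"
        by simp
      finally have "ennreal (norm (cutoff_rhs z0 s W V z * kern 0 (z - \<zeta>))) \<le>
          ennreal ((M + 2 * s) * (1 / cmod (\<zeta> - z) * indicator (ball z0 s) z * norm (W z)))"
        by (rule ennreal_leI)
      also have "\<dots> = ennreal (M + 2 * s) * (ennreal (1 / cmod (\<zeta> - z)) * indicator (ball z0 s) z * ennreal (norm (W z)))"
        using M \<open>0 < s\<close> by (simp add: indicator_def ennreal_mult[symmetric] del: ennreal_plus)
      finally show "ennreal (norm (cutoff_rhs z0 s W V z * kern 0 (z - \<zeta>))) \<le> \<dots>" .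
    qed
    also have "\<dots> = ennreal (M + 2 * s) * ?I"
      by (rule nn_integral_cmult) measurable
    finally have *: "ennreal (?k * norm (W \<zeta>)) \<le> ennreal (M + 2 * s) * ?I" .
    have "ennreal (norm (W \<zeta>)) = ennreal (1 / ?k) * ennreal (?k * norm (W \<zeta>))"
      using k by (subst ennreal_mult[symmetric]) auto
    also have "\<dots> \<le> ennreal (1 / ?k) * (ennreal (M + 2 * s) * ?I)"
      by (intro mult_left_mono *) simp
    also have "\<dots> = ennreal c * ?I"
      using k M \<open>0 < s\<close> by (simp add: c_def ennreal_mult[symmetric] mult.assoc[symmetric] del: ennreal_plus)
    finally show "ennreal (norm (W \<zeta>)) \<le> ennreal c * ?I" .
  qed
qed

end

text \<open>One iteration step: insert the pointwise bound for w under the integral with kernel k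
  and exchange the integrals by Tonelli. The composed kernel is estimated by m except at the single
  point y = \<zeta>, a null set.\<close>

lemma nn_integral_kernel_compose:
  fixes w :: "complex \<Rightarrow> ennreal" and k :: "complex \<Rightarrow> ennreal" and l m
  assumes [measurable]: "w \<in> borel_measurable borel" "k \<in> borel_measurable borel"
      "case_prod l \<in> borel_measurable (borel \<Otimes>\<^sub>M borel)" "B \<in> sets borel" "D \<in> sets borel"
    and w: "AE z in lborel. z \<in> B \<longrightarrow> w z \<le> c * (\<integral>\<^sup>+y. l z y * indicator D y * w y \<partial>lborel)"
    and m: "\<And>y. y \<noteq> \<zeta> \<Longrightarrow> (\<integral>\<^sup>+z. k z * l z y * indicator B z \<partial>lborel) \<le> m y"
  shows "(\<integral>\<^sup>+z. k z * indicator B z * w z \<partial>lborel) \<le> c * (\<integral>\<^sup>+y. m y * indicator D y * w y \<partial>lborel)"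
proof -
  have "(\<integral>\<^sup>+z. k z * indicator B z * w z \<partial>lborel) \<le>
      (\<integral>\<^sup>+z. k z * indicator B z * (c * (\<integral>\<^sup>+y. l z y * indicator D y * w y \<partial>lborel)) \<partial>lborel)"
    using w by (intro nn_integral_mono_AE) (auto elim!: eventually_mono simp: indicator_def intro!: mult_left_mono)
  also have "\<dots> = (\<integral>\<^sup>+z. c * (\<integral>\<^sup>+y. k z * indicator B z * (l z y * indicator D y * w y) \<partial>lborel) \<partial>lborel)"
  proof (rule nn_integral_cong)
    fix z :: complex
    have "(\<integral>\<^sup>+y. k z * indicator B z * (l z y * indicator D y * w y) \<partial>lborel) =
        k z * indicator B z * (\<integral>\<^sup>+y. l z y * indicator D y * w y \<partial>lborel)"
      by (rule nn_integral_cmult) measurable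
    then show "k z * indicator B z * (c * (\<integral>\<^sup>+y. l z y * indicator D y * w y \<partial>lborel)) =
        c * (\<integral>\<^sup>+y. k z * indicator B z * (l z y * indicator D y * w y) \<partial>lborel)"
      by (simp only: mult.left_commute[of _ c])
  qed
  also have "\<dots> = c * (\<integral>\<^sup>+z. (\<integral>\<^sup>+y. k z * indicator B z * (l z y * indicator D y * w y) \<partial>lborel) \<partial>lborel)"
    by (rule nn_integral_cmult) measurable
  also have "(\<integral>\<^sup>+z. (\<integral>\<^sup>+y. k z * indicator B z * (l z y * indicator D y * w y) \<partial>lborel) \<partial>lborel) =
      (\<integral>\<^sup>+y. (\<integral>\<^sup>+z. k z * indicator B z * (l z y * indicator D y * w y) \<partial>lborel) \<partial>lborel)"
    by (rule lborel_pair.Fubini'[symmetric]) measurable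
  also have "\<dots> = (\<integral>\<^sup>+y. (\<integral>\<^sup>+z. k z * l z y * indicator B z \<partial>lborel) * (indicator D y * w y) \<partial>lborel)"
  proof (rule nn_integral_cong)
    fix y :: complex
    have "(\<integral>\<^sup>+z. k z * indicator B z * (l z y * indicator D y * w y) \<partial>lborel) =
        (\<integral>\<^sup>+z. k z * l z y * indicator B z * (indicator D y * w y) \<partial>lborel)"
      by (intro nn_integral_cong) (simp only: mult_ac)
    also have "\<dots> = (\<integral>\<^sup>+z. k z * l z y * indicator B z \<partial>lborel) * (indicator D y * w y)"
      by (rule nn_integral_multc) measurable
    finally show "(\<integral>\<^sup>+z. k z * indicator B z * (l z y * indicator D y * w y) \<partial>lborel) = \<dots>" .
  qed
  also have "\<dots> \<le> (\<integral>\<^sup>+y. m y * (indicator D y * w y) \<partial>lborel)"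
  proof (rule nn_integral_mono_AE)
    have "AE y in lborel. y \<noteq> \<zeta>"
      by (rule AE_lborel_singleton)
    then show "AE y in lborel. (\<integral>\<^sup>+z. k z * l z y * indicator B z \<partial>lborel) * (indicator D y * w y) \<le> m y * (indicator D y * w y)"
      by eventually_elim (intro mult_right_mono m zero_le)
  qed
  finally show ?thesis by (simp only: mult.assoc mult_left_mono zero_le)
qed


text \<open>Each use of the pointwise bound shrinks the ball, so the three uses run through the
  radii 4 r, 3 r, 2 r, r; all kernel integrals are enlarged to the ball of radius 4 r to share the
  constant K.\<close>

lemma local_sol_essentially_bounded:
  assumes "r > 0" "M \<ge> 0"
  obtains C where "C > 0" "\<And>W V. local_sol M z0 (4 * r) W V \<Longrightarrow>
      AE \<zeta> in lborel. \<zeta> \<in> ball z0 r \<longrightarrow> norm (W \<zeta>) \<le> C * (LINT z|lborel. norm (W z))"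
proof -
  let ?B = "\<lambda>i. ball z0 (i * r)"
  obtain K where K: "K > 0"
    "\<And>x. (\<integral>\<^sup>+z. ennreal (1 / cmod (x - z)) * indicator (?B 4) z \<partial>lborel) \<le> ennreal K"
    "\<And>x y. x \<noteq> y \<Longrightarrow> (\<integral>\<^sup>+z. ennreal (1 / cmod (x - z) * (1 / cmod (z - y))) * indicator (?B 4) z \<partial>lborel)
        \<le> ennreal (K / sqrt (cmod (x - y)))"
    "\<And>x y. (\<integral>\<^sup>+z. ennreal (1 / cmod (x - z) * (1 / sqrt (cmod (z - y)))) * indicator (?B 4) z \<partial>lborel) \<le> ennreal K"
    by (rule kernel_bounds[OF ball_sets_borel bounded_ball, of z0 "4 * r"]) (use that in blast)
  have sub: "indicator (?B i) z \<le> (indicator (?B 4) z :: ennreal)" if "i \<le> 4" for i z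
    using that \<open>r > 0\<close> by (auto simp: indicator_def intro: less_le_trans mult_right_mono)
  define c where "c s t = (M + 2 * s) / (poisson_mass * exp (- (1 / (s\<^sup>2 - t\<^sup>2))))" for s t
  have c: "c s t \<ge> 0" if "s > 0" for s t
    using that \<open>M \<ge> 0\<close> poisson_mass_pos by (simp add: c_def)
  \<comment> \<open>The constants of the three pointwise bounds times one K for each of the two
    compositions; the added 1 only secures positivity.\<close>
  define C where "C = c (2 * r) r * (c (3 * r) (2 * r) * c (4 * r) (3 * r)) * K * K + 1"
  have C: "C > 0" using K(1) c \<open>r > 0\<close> by (simp add: C_def add_nonneg_pos)
  have bound: "AE \<zeta> in lborel. \<zeta> \<in> ball z0 r \<longrightarrow> norm (W \<zeta>) \<le> C * (LINT z|lborel. norm (W z))"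
    if sol: "local_sol M z0 (4 * r) W V" for W V
  proof -
    note pw = local_sol_pointwise[OF sol \<open>M \<ge> 0\<close>, folded c_def]
    have int: "integrable lborel W" and [measurable]: "W \<in> borel_measurable borel"
      using local_sol_integrable[OF sol] local_sol_measurable[OF sol] \<open>M \<ge> 0\<close> by auto
    let ?w = "\<lambda>z. ennreal (norm (W z))"
    let ?k = "\<lambda>x z. ennreal (1 / cmod (x - z))"
    let ?h = "\<lambda>x z. ennreal (K / sqrt (cmod (x - z)))"
    let ?a = "ennreal (c (4 * r) (3 * r))" and ?b = "ennreal (c (3 * r) (2 * r))" and ?c = "ennreal (c (2 * r) r)"
    have 1: "AE \<zeta> in lborel. \<zeta> \<in> ?B 3 \<longrightarrow> ?w \<zeta> \<le> ?a * (\<integral>\<^sup>+z. ?k \<zeta> z * indicator (?B 4) z * ?w z \<partial>lborel)"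
      using pw[of "3 * r" "4 * r"] \<open>r > 0\<close> by simp
    \<comment> \<open>Composing 1/|.| with 1/|.| yields the kernel K |.|^(-1/2).\<close>
    have 2: "(\<integral>\<^sup>+z. ?k \<zeta> z * indicator (?B 3) z * ?w z \<partial>lborel) \<le>
        ?a * (\<integral>\<^sup>+y. ?h \<zeta> y * indicator (?B 4) y * ?w y \<partial>lborel)" for \<zeta>
    proof (rule nn_integral_kernel_compose[OF _ _ _ _ _ 1])
      fix y assume "y \<noteq> \<zeta>"
      have "(\<integral>\<^sup>+z. ?k \<zeta> z * ?k z y * indicator (?B 3) z \<partial>lborel) \<le>
          (\<integral>\<^sup>+z. ennreal (1 / cmod (\<zeta> - z) * (1 / cmod (z - y))) * indicator (?B 4) z \<partial>lborel)"
        by (intro nn_integral_mono mult_mono sub) (auto simp: ennreal_mult[symmetric])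
      also have "\<dots> \<le> ?h \<zeta> y" using K(3)[of \<zeta> y] \<open>y \<noteq> \<zeta>\<close> by simp
      finally show "(\<integral>\<^sup>+z. ?k \<zeta> z * ?k z y * indicator (?B 3) z \<partial>lborel) \<le> ?h \<zeta> y" .
    qed measurable
    have 3: "AE \<zeta> in lborel. \<zeta> \<in> ?B 2 \<longrightarrow> ?w \<zeta> \<le> ?b * ?a * (\<integral>\<^sup>+y. ?h \<zeta> y * indicator (?B 4) y * ?w y \<partial>lborel)"
    proof -
      have "AE \<zeta> in lborel. \<zeta> \<in> ?B 2 \<longrightarrow> ?w \<zeta> \<le> ?b * (\<integral>\<^sup>+z. ?k \<zeta> z * indicator (?B 3) z * ?w z \<partial>lborel)"
        using pw[of "2 * r" "3 * r"] \<open>r > 0\<close> by simp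
      then show ?thesis
        by eventually_elim (auto simp only: mult.assoc[of ?b ?a] intro: order_trans[OF _ mult_left_mono[OF 2 zero_le]])
    qed
    \<comment> \<open>Composing 1/|.| with K |.|^(-1/2) removes the singularity: the bound is the
      constant K * K, so only the integral of the norm of W remains.\<close>
    have 4: "(\<integral>\<^sup>+z. ?k \<zeta> z * indicator (?B 2) z * ?w z \<partial>lborel) \<le>
        ?b * ?a * (\<integral>\<^sup>+y. ennreal (K * K) * indicator (?B 4) y * ?w y \<partial>lborel)" for \<zeta>
    proof (rule nn_integral_kernel_compose[OF _ _ _ _ _ 3])
      fix y
      have eq: "?k \<zeta> z * ?h z y = ennreal K * ennreal (1 / cmod (\<zeta> - z) * (1 / sqrt (cmod (z - y))))" for z
        using K(1) by (simp add: ennreal_mult[symmetric])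
      have "(\<integral>\<^sup>+z. ?k \<zeta> z * ?h z y * indicator (?B 2) z \<partial>lborel) \<le>
          (\<integral>\<^sup>+z. ennreal K * (ennreal (1 / cmod (\<zeta> - z) * (1 / sqrt (cmod (z - y)))) * indicator (?B 4) z) \<partial>lborel)"
        unfolding eq mult.assoc by (intro nn_integral_mono mult_left_mono sub) auto
      also have "\<dots> = ennreal K * (\<integral>\<^sup>+z. ennreal (1 / cmod (\<zeta> - z) * (1 / sqrt (cmod (z - y)))) * indicator (?B 4) z \<partial>lborel)"
        by (rule nn_integral_cmult) measurable
      also have "\<dots> \<le> ennreal K * ennreal K" by (intro mult_left_mono K(4)) simp
      finally show "(\<integral>\<^sup>+z. ?k \<zeta> z * ?h z y * indicator (?B 2) z \<partial>lborel) \<le> ennreal (K * K)"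
        using K(1) by (simp add: ennreal_mult)
    qed measurable
    have 5: "(\<integral>\<^sup>+y. ennreal (K * K) * indicator (?B 4) y * ?w y \<partial>lborel) \<le> ennreal (K * K) * ennreal (LINT z|lborel. norm (W z))"
    proof -
      have "(\<integral>\<^sup>+y. ennreal (K * K) * indicator (?B 4) y * ?w y \<partial>lborel) \<le> (\<integral>\<^sup>+y. ennreal (K * K) * ?w y \<partial>lborel)"
        by (intro nn_integral_mono) (auto simp: indicator_def)
      also have "\<dots> = ennreal (K * K) * (\<integral>\<^sup>+y. ?w y \<partial>lborel)"
        by (rule nn_integral_cmult) measurable
      also have "(\<integral>\<^sup>+y. ?w y \<partial>lborel) = ennreal (LINT z|lborel. norm (W z))"
        by (rule nn_integral_eq_integral) (use int in auto)
      finally show ?thesis .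
    qed
    have "AE \<zeta> in lborel. \<zeta> \<in> ball z0 r \<longrightarrow> ?w \<zeta> \<le> ?c * (\<integral>\<^sup>+z. ?k \<zeta> z * indicator (?B 2) z * ?w z \<partial>lborel)"
      using pw[of r "2 * r"] \<open>r > 0\<close> by simp
    then show ?thesis
    proof (eventually_elim, intro impI)
      fix \<zeta> assume "\<zeta> \<in> ball z0 r \<longrightarrow> ?w \<zeta> \<le> ?c * (\<integral>\<^sup>+z. ?k \<zeta> z * indicator (?B 2) z * ?w z \<partial>lborel)" "\<zeta> \<in> ball z0 r"
      then have "?w \<zeta> \<le> ?c * (\<integral>\<^sup>+z. ?k \<zeta> z * indicator (?B 2) z * ?w z \<partial>lborel)" by simp
      also have "\<dots> \<le> ?c * (?b * ?a * (ennreal (K * K) * ennreal (LINT z|lborel. norm (W z))))"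
        by (intro mult_left_mono order_trans[OF 4] 5) auto
      also have "\<dots> = ennreal ((C - 1) * (LINT z|lborel. norm (W z)))"
        using c \<open>r > 0\<close> K(1) by (simp add: C_def ennreal_mult[symmetric] mult_ac)
      also have "\<dots> \<le> ennreal (C * (LINT z|lborel. norm (W z)))"
        by (intro ennreal_leI mult_right_mono) auto
      finally show "norm (W \<zeta>) \<le> C * (LINT z|lborel. norm (W z))"
        using C by (simp add: ennreal_le_iff)
    qed
  qed
  show ?thesis by (rule that[OF C bound])
qed

lemma norm_diff_jc_mult: "norm (F * jc u - F * jc v) = norm F * cmod (u - v)"
  by (simp add: norm_mult_jc flip: right_diff_distrib jc_diff)

text \<open>For a bounded density on a bounded set the integral converges at every \<zeta>. The
  difference of two kernels is (x - y) / ((z - x)(z - y)); the bound C |x - y|^(-1/2) for two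
  composed kernels turns the factor |x - y| into |x - y|^(1/2).\<close>

lemma potential_bounded_continuous:
  fixes B :: "complex set"
  assumes B: "B \<in> sets borel" "bounded B"
  obtains C where "C > 0"
    "\<And>F S. F \<in> borel_measurable borel \<Longrightarrow> AE z in lborel. norm (F z) \<le> S * indicator B z \<Longrightarrow> S \<ge> 0 \<Longrightarrow>
       continuous_on UNIV (\<lambda>\<zeta>. LINT z|lborel. F z * kern 0 (z - \<zeta>)) \<and>
       (\<forall>\<zeta>. norm (LINT z|lborel. F z * kern 0 (z - \<zeta>)) \<le> C * S)"
proof -
  note [measurable] = B(1)
  obtain C where C: "C > 0"
    "\<And>x. (\<integral>\<^sup>+z. ennreal (1 / cmod (x - z)) * indicator B z \<partial>lborel) \<le> ennreal C"
    "\<And>x y. x \<noteq> y \<Longrightarrow> (\<integral>\<^sup>+z. ennreal (1 / cmod (x - z) * (1 / cmod (z - y))) * indicator B z \<partial>lborel)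
        \<le> ennreal (C / sqrt (cmod (x - y)))"
    "\<And>x y. (\<integral>\<^sup>+z. ennreal (1 / cmod (x - z) * (1 / sqrt (cmod (z - y)))) * indicator B z \<partial>lborel) \<le> ennreal C"
    by (rule kernel_bounds[OF B]) (use that in blast)
  show ?thesis
  proof (rule that[OF C(1)], intro conjI allI)
    fix F :: "complex \<Rightarrow> bicomplex" and S :: real
    assume [measurable]: "F \<in> borel_measurable borel" and F: "AE z in lborel. norm (F z) \<le> S * indicator B z" and S: "S \<ge> 0"
    let ?U = "\<lambda>\<zeta>. LINT z|lborel. F z * kern 0 (z - \<zeta>)"
    have nn: "(\<integral>\<^sup>+z. ennreal (norm (F z * kern 0 (z - \<zeta>))) \<partial>lborel) \<le> ennreal (C * S)" for \<zeta>
    proof -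
      have "(\<integral>\<^sup>+z. ennreal (norm (F z * kern 0 (z - \<zeta>))) \<partial>lborel) \<le>
          (\<integral>\<^sup>+z. ennreal S * (ennreal (1 / cmod (\<zeta> - z)) * indicator B z) \<partial>lborel)"
      proof (rule nn_integral_mono_AE)
        show "AE z in lborel. ennreal (norm (F z * kern 0 (z - \<zeta>))) \<le> ennreal S * (ennreal (1 / cmod (\<zeta> - z)) * indicator B z)"
          using F
        proof eventually_elim
          fix z assume "norm (F z) \<le> S * indicator B z"
          then have "norm (F z * kern 0 (z - \<zeta>)) \<le> S * indicator B z * (1 / cmod (\<zeta> - z))"
            unfolding norm_mult_kern norm_kern_0 norm_minus_commute[of z] by (intro mult_right_mono) auto
          then show "ennreal (norm (F z * kern 0 (z - \<zeta>))) \<le> ennreal S * (ennreal (1 / cmod (\<zeta> - z)) * indicator B z)"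
            using S by (auto simp: indicator_def ennreal_mult[symmetric] intro!: ennreal_leI)
        qed
      qed
      also have "\<dots> = ennreal S * (\<integral>\<^sup>+z. ennreal (1 / cmod (\<zeta> - z)) * indicator B z \<partial>lborel)"
        by (rule nn_integral_cmult) measurable
      also have "\<dots> \<le> ennreal S * ennreal C" by (intro mult_left_mono C(2)) simp
      also have "\<dots> = ennreal (C * S)" using C(1) S by (simp add: ennreal_mult mult.commute)
      finally show ?thesis .
    qed
    have int: "integrable lborel (\<lambda>z. F z * kern 0 (z - \<zeta>))" for \<zeta>
    proof (rule integrableI_bounded)
      show "(\<integral>\<^sup>+z. ennreal (norm (F z * kern 0 (z - \<zeta>))) \<partial>lborel) < \<infinity>"
        using nn[of \<zeta>] by (auto intro: le_less_trans)
    qed measurable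
    show "norm (?U \<zeta>) \<le> C * S" for \<zeta>
      using order_trans[OF integral_norm_bound_ennreal[OF int] nn, of \<zeta>] C(1) S by (simp add: ennreal_le_iff)
    have hoelder: "norm (?U x - ?U y) \<le> S * C * sqrt (cmod (x - y))" for x y
    proof (cases "x = y")
      case False
      have "ennreal (norm (?U x - ?U y)) = ennreal (norm (LINT z|lborel. F z * kern 0 (z - x) - F z * kern 0 (z - y)))"
        by (simp add: int)
      also have "\<dots> \<le> (\<integral>\<^sup>+z. ennreal (norm (F z * kern 0 (z - x) - F z * kern 0 (z - y))) \<partial>lborel)"
        by (intro integral_norm_bound_ennreal Bochner_Integration.integrable_diff int)
      also have "\<dots> \<le> (\<integral>\<^sup>+z. ennreal (S * cmod (x - y)) * (ennreal (1 / cmod (x - z) * (1 / cmod (z - y))) * indicator B z) \<partial>lborel)"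
      proof (rule nn_integral_mono_AE)
        have "AE z in lborel. z \<noteq> x" "AE z in lborel. z \<noteq> y" by (rule AE_lborel_singleton)+
        with F show "AE z in lborel. ennreal (norm (F z * kern 0 (z - x) - F z * kern 0 (z - y))) \<le>
            ennreal (S * cmod (x - y)) * (ennreal (1 / cmod (x - z) * (1 / cmod (z - y))) * indicator B z)"
        proof eventually_elim
          fix z assume z: "norm (F z) \<le> S * indicator B z" "z \<noteq> x" "z \<noteq> y"
          have "cmod (inverse (z - x) - inverse (z - y)) = cmod (x - y) * (1 / cmod (x - z) * (1 / cmod (z - y)))"
          proof -
            have "inverse (z - x) - inverse (z - y) = (x - y) * (1 / (z - x) * (1 / (z - y)))"
              using z division_ring_inverse_diff[of "z - x" "z - y"] by (simp add: divide_inverse mult_ac)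
            then show ?thesis
              by (simp only: norm_mult norm_divide norm_one norm_minus_commute[of z x])
          qed
          then have "norm (F z * kern 0 (z - x) - F z * kern 0 (z - y)) =
              norm (F z) * (cmod (x - y) * (1 / cmod (x - z) * (1 / cmod (z - y))))"
            by (simp only: kern_0 norm_diff_jc_mult)
          also have "\<dots> \<le> S * indicator B z * (cmod (x - y) * (1 / cmod (x - z) * (1 / cmod (z - y))))"
            using z(1) by (intro mult_right_mono) auto
          finally show "ennreal (norm (F z * kern 0 (z - x) - F z * kern 0 (z - y))) \<le>
            ennreal (S * cmod (x - y)) * (ennreal (1 / cmod (x - z) * (1 / cmod (z - y))) * indicator B z)"
            using S by (auto simp: indicator_def ennreal_mult[symmetric] mult.assoc intro!: ennreal_leI)
        qed
      qed
      also have "\<dots> = ennreal (S * cmod (x - y)) * (\<integral>\<^sup>+z. ennreal (1 / cmod (x - z) * (1 / cmod (z - y))) * indicator B z \<partial>lborel)"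
        by (rule nn_integral_cmult) measurable
      also have "\<dots> \<le> ennreal (S * cmod (x - y)) * ennreal (C / sqrt (cmod (x - y)))"
        by (intro mult_left_mono C(3) False) simp
      also have "\<dots> = ennreal (S * cmod (x - y) * (C / sqrt (cmod (x - y))))"
        using S C(1) by (subst ennreal_mult[symmetric]) auto
      also have "S * cmod (x - y) * (C / sqrt (cmod (x - y))) = S * C * sqrt (cmod (x - y))"
        using False by (simp add: field_simps)
      finally show ?thesis using S C(1) by (simp add: ennreal_le_iff)
    qed simp
    have "isCont ?U x" for x
    proof -
      have "((\<lambda>y. S * C * sqrt (cmod (y - x))) \<longlongrightarrow> S * C * sqrt (cmod (x - x))) (at x)"
        by (intro tendsto_intros)
      then have "((\<lambda>y. S * C * sqrt (cmod (y - x))) \<longlongrightarrow> 0) (at x)" by simp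
      then have "((\<lambda>y. ?U y - ?U x) \<longlongrightarrow> 0) (at x)"
        by (rule Lim_null_comparison[rotated]) (simp add: hoelder)
      then show ?thesis unfolding isCont_def by (rule LIM_zero_cancel)
    qed
    then show "continuous_on UNIV ?U" by (simp add: continuous_at_imp_continuous_on)
  qed
qed

text \<open>Essential boundedness on the ball of radius r makes the density
  \<open>cutoff_rhs\<close> of that radius bounded, hence its potential continuous. The cutoff is at
  least \<kappa> on the ball of radius r/2, where division recovers W.\<close>

lemma local_sol_estimate:
  assumes "r > 0" "M \<ge> 0"
  obtains C where "C > 0" "\<And>W V. local_sol M z0 (4 * r) W V \<Longrightarrow>
     \<exists>U. continuous_on (ball z0 (r / 2)) U \<and> (AE \<zeta> in lborel. \<zeta> \<in> ball z0 (r / 2) \<longrightarrow> U \<zeta> = W \<zeta>) \<and>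
         (\<forall>\<zeta>\<in>ball z0 (r / 2). norm (U \<zeta>) \<le> C * (LINT z|lborel. norm (W z)))"
proof -
  obtain C1 where C1: "C1 > 0" "\<And>W V. local_sol M z0 (4 * r) W V \<Longrightarrow>
      AE \<zeta> in lborel. \<zeta> \<in> ball z0 r \<longrightarrow> norm (W \<zeta>) \<le> C1 * (LINT z|lborel. norm (W z))"
    by (rule local_sol_essentially_bounded[OF assms]) (use that in blast)
  obtain C2 where C2: "C2 > 0" "\<And>F S. F \<in> borel_measurable borel \<Longrightarrow>
       AE z in lborel. norm (F z) \<le> S * indicator (ball z0 r) z \<Longrightarrow> S \<ge> 0 \<Longrightarrow>
       continuous_on UNIV (\<lambda>\<zeta>. LINT z|lborel. F z * kern 0 (z - \<zeta>)) \<and>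
       (\<forall>\<zeta>. norm (LINT z|lborel. F z * kern 0 (z - \<zeta>)) \<le> C2 * S)"
    by (rule potential_bounded_continuous[OF ball_sets_borel bounded_ball, of z0 r]) (use that in blast)
  define \<kappa> where "\<kappa> = exp (- (1 / (r\<^sup>2 - (r / 2)\<^sup>2)))"
  have \<kappa>: "\<kappa> > 0" by (simp add: \<kappa>_def)
  have cut: "\<kappa> \<le> cutoff z0 r \<zeta>" if "\<zeta> \<in> ball z0 (r / 2)" for \<zeta>
    unfolding \<kappa>_def using that \<open>r > 0\<close> by (intro cutoff_lower) auto
  define C where "C = 1 / (poisson_mass * \<kappa>) * (C2 * ((M + 2 * r) * C1))"
  show ?thesis
  proof
    show "C > 0"
      using C1(1) C2(1) \<kappa> poisson_mass_pos assms by (simp add: C_def add_nonneg_pos)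
    fix W V assume sol: "local_sol M z0 (4 * r) W V"
    let ?F = "cutoff_rhs z0 r W V" and ?N = "LINT z|lborel. norm (W z)"
    let ?P = "\<lambda>\<zeta>. LINT z|lborel. ?F z * kern 0 (z - \<zeta>)"
    let ?S = "(M + 2 * r) * (C1 * ?N)"
    have S: "?S \<ge> 0" using assms C1(1) by simp
    have "AE z in lborel. norm (?F z) \<le> ?S * indicator (ball z0 r) z"
      using C1(2)[OF sol]
    proof eventually_elim
      fix z assume z: "z \<in> ball z0 r \<longrightarrow> norm (W z) \<le> C1 * ?N"
      show "norm (?F z) \<le> ?S * indicator (ball z0 r) z"
      proof (cases "z \<in> ball z0 r")
        case True
        then have "(M + 2 * r) * norm (W z) \<le> ?S" using z assms by (intro mult_left_mono) auto
        then show ?thesis using norm_cutoff_rhs_le[OF sol assms(2,1), of z] True by simp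
      next
        case False
        then show ?thesis using norm_cutoff_rhs_le[OF sol assms(2,1), of z] by simp
      qed
    qed
    from C2(2)[OF cutoff_rhs_measurable[OF sol assms(2)] this S]
    have P: "continuous_on UNIV ?P" "\<And>\<zeta>. norm (?P \<zeta>) \<le> C2 * ?S" by auto
    \<comment> \<open>The representation formula solved for W; unlike W, this expression is
      continuous wherever the cutoff is nonzero.\<close>
    define U where "U \<zeta> = (- 1 / (poisson_mass * cutoff z0 r \<zeta>)) *\<^sub>R ?P \<zeta>" for \<zeta>
    have nz: "poisson_mass * cutoff z0 r \<zeta> \<noteq> 0" if "\<zeta> \<in> ball z0 (r / 2)" for \<zeta>
      using cut[OF that] \<kappa> poisson_mass_pos by auto
    show "\<exists>U. continuous_on (ball z0 (r / 2)) U \<and> (AE \<zeta> in lborel. \<zeta> \<in> ball z0 (r / 2) \<longrightarrow> U \<zeta> = W \<zeta>) \<and>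
         (\<forall>\<zeta>\<in>ball z0 (r / 2). norm (U \<zeta>) \<le> C * ?N)"
    proof (intro exI conjI ballI)
      show "continuous_on (ball z0 (r / 2)) U"
        unfolding U_def using nz
        by (intro continuous_intros continuous_on_subset[OF P(1)] continuous_at_imp_continuous_on ballI isCont_cutoff) auto
      have "0 < r" "r \<le> 4 * r" using assms by auto
      from local_sol_representation[OF sol assms(2) this]
      show "AE \<zeta> in lborel. \<zeta> \<in> ball z0 (r / 2) \<longrightarrow> U \<zeta> = W \<zeta>"
      proof (eventually_elim, intro impI)
        fix \<zeta> assume eq: "poisson_mass *\<^sub>R (cutoff z0 r \<zeta> *\<^sub>R W \<zeta>) = - ?P \<zeta>" and \<zeta>: "\<zeta> \<in> ball z0 (r / 2)"
        then have "?P \<zeta> = - ((poisson_mass * cutoff z0 r \<zeta>) *\<^sub>R W \<zeta>)" by simp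
        then show "U \<zeta> = W \<zeta>" using nz[OF \<zeta>] by (simp add: U_def)
      qed
      fix \<zeta> assume \<zeta>: "\<zeta> \<in> ball z0 (r / 2)"
      have "norm (U \<zeta>) = 1 / (poisson_mass * cutoff z0 r \<zeta>) * norm (?P \<zeta>)"
        using cut[OF \<zeta>] \<kappa> poisson_mass_pos by (simp add: U_def abs_mult)
      also have "\<dots> \<le> 1 / (poisson_mass * \<kappa>) * (C2 * ?S)"
        using cut[OF \<zeta>] \<kappa> poisson_mass_pos P(2)
        by (intro mult_mono divide_left_mono mult_left_mono mult_pos_pos) auto
      finally show "norm (U \<zeta>) \<le> C * ?N" by (simp add: C_def mult_ac)
    qed
  qed
qed

section \<open>Lebesgue spaces\<close>

lemma bc_space_Lp_measurable:
  "F \<in> bc_space (Lp p \<Omega>) \<Longrightarrow> F \<in> borel_measurable (lebesgue_on \<Omega>)"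
  by (rule borel_measurable_bicomplexI) (simp_all add: bc_space_def Lp_def)

lemma bc_space_Linf_esssup:
  assumes "F \<in> bc_space (Lp \<infinity> \<Omega>)"
  shows "esssup (lebesgue_on \<Omega>) (\<lambda>z. ennreal (norm (F z))) < \<infinity>"
proof -
  note [measurable] = bc_space_Lp_measurable[OF assms]
  let ?M = "lebesgue_on \<Omega>"
  let ?s = "esssup ?M (\<lambda>z. ennreal (cmod (Sc (F z))))" and ?v = "esssup ?M (\<lambda>z. ennreal (cmod (Vec (F z))))"
  have fin: "?s + ?v < \<infinity>"
    using assms by (simp add: bc_space_def Lp_def)
  have "esssup ?M (\<lambda>z. ennreal (norm (F z))) \<le> ?s + ?v"
  proof (rule esssup_I)
    show "AE z in ?M. ennreal (norm (F z)) \<le> ?s + ?v"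
      using esssup_AE[of "\<lambda>z. ennreal (cmod (Sc (F z)))" ?M] esssup_AE[of "\<lambda>z. ennreal (cmod (Vec (F z)))" ?M]
    proof eventually_elim
      fix z assume le: "ennreal (cmod (Sc (F z))) \<le> ?s" "ennreal (cmod (Vec (F z))) \<le> ?v"
      have "ennreal (norm (F z)) \<le> ennreal (cmod (Sc (F z)) + cmod (Vec (F z)))"
        by (intro ennreal_leI norm_bicomplex_le)
      also have "\<dots> \<le> ?s + ?v" using le by (simp add: add_mono)
      finally show "ennreal (norm (F z)) \<le> ?s + ?v" .
    qed
  qed measurable
  also note fin
  finally show ?thesis .
qed

lemma Lp_norm_inf_AE:
  assumes "F \<in> bc_space (Lp \<infinity> \<Omega>)"
  shows "AE z in lebesgue_on \<Omega>. norm (F z) \<le> Lp_norm \<infinity> \<Omega> F"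
  using esssup_AE[of "\<lambda>z. ennreal (norm (F z))" "lebesgue_on \<Omega>"]
proof eventually_elim
  fix z assume le: "ennreal (norm (F z)) \<le> esssup (lebesgue_on \<Omega>) (\<lambda>z. ennreal (norm (F z)))"
  have "enn2real (ennreal (norm (F z))) \<le> enn2real (esssup (lebesgue_on \<Omega>) (\<lambda>z. ennreal (norm (F z))))"
    using bc_space_Linf_esssup[OF assms] by (intro enn2real_mono le) (simp add: less_top)
  then show "norm (F z) \<le> Lp_norm \<infinity> \<Omega> F" by (simp add: Lp_norm_def)
qed

lemma Lp_norm_nonneg: "Lp_norm p \<Omega> F \<ge> 0"
  by (simp add: Lp_norm_def)

text \<open>Membership is componentwise whereas the norm is joint; |F| is at most twice the larger
  component, which accounts for the factor 2^q.\<close>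

lemma bc_space_Lp_integrable_powr:
  assumes F: "F \<in> bc_space (Lp p \<Omega>)" and "p \<noteq> \<infinity>" "q = enn2real p" "q > 1"
  shows "integrable (lebesgue_on \<Omega>) (\<lambda>z. norm (F z) powr q)"
proof (rule Bochner_Integration.integrable_bound)
  note [measurable] = bc_space_Lp_measurable[OF F]
  show "integrable (lebesgue_on \<Omega>) (\<lambda>z. 2 powr q * (cmod (Sc (F z)) powr q + cmod (Vec (F z)) powr q))"
    using F assms by (simp add: bc_space_def Lp_def)
  show "AE z in lebesgue_on \<Omega>. norm (norm (F z) powr q) \<le>
      norm (2 powr q * (cmod (Sc (F z)) powr q + cmod (Vec (F z)) powr q))"
  proof (rule AE_I2)
    fix z
    let ?m = "max (cmod (Sc (F z))) (cmod (Vec (F z)))"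
    have "norm (F z) powr q \<le> (2 * ?m) powr q"
      using \<open>q > 1\<close> norm_bicomplex_le[of "F z"] by (intro powr_mono2) auto
    also have "\<dots> = 2 powr q * ?m powr q"
      by (rule powr_mult)
    also have "\<dots> \<le> 2 powr q * (cmod (Sc (F z)) powr q + cmod (Vec (F z)) powr q)"
      by (intro mult_left_mono) (auto simp: max_def)
    finally show "norm (norm (F z) powr q) \<le> norm (2 powr q * (cmod (Sc (F z)) powr q + cmod (Vec (F z)) powr q))"
      by simp
  qed
  show "(\<lambda>z. norm (F z) powr q) \<in> borel_measurable (lebesgue_on \<Omega>)" by measurable
qed

text \<open>The pointwise inequality \<open>t \<le> l\<^sup>1\<^sup>-\<^sup>q t\<^sup>q + l\<close> with \<open>l\<close> the \<open>L\<^sup>q\<close> norm replaces Hoelder's inequality.\<close>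

lemma Lp_imp_L1:
  assumes \<Omega>: "\<Omega> \<in> lmeasurable" and "1 < p" and F: "F \<in> bc_space (Lp p \<Omega>)"
  shows "integrable (lebesgue_on \<Omega>) F"
    and "(LINT z|lebesgue_on \<Omega>. norm (F z)) \<le> (1 + measure lebesgue \<Omega>) * Lp_norm p \<Omega> F"
proof -
  let ?M = "lebesgue_on \<Omega>" and ?l = "Lp_norm p \<Omega> F" and ?m = "measure lebesgue \<Omega>"
  note [measurable] = bc_space_Lp_measurable[OF F]
  have const: "integrable ?M (\<lambda>z. c)" "(LINT z|?M. c) = ?m * c" for c :: real
  proof -
    have "finite_measure ?M"
      using \<Omega> by (simp add: finite_measure_lebesgue_on)
    then show "integrable ?M (\<lambda>z. c)" by (rule finite_measure.integrable_const)
    show "(LINT z|?M. c) = ?m * c"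
      using \<Omega> by (simp add: measure_restrict_space fmeasurableD)
  qed
  \<comment> \<open>A single majorant with this integral yields both claims: the constant ?l for
    infinite p, 0 if the norm vanishes, and otherwise the right-hand side of the pointwise
    inequality.\<close>
  have "\<exists>h. integrable ?M h \<and> (AE z in ?M. norm (F z) \<le> h z) \<and> (LINT z|?M. h z) \<le> (1 + ?m) * ?l"
  proof (cases "p = \<infinity>")
    case True
    show ?thesis
      using Lp_norm_inf_AE[of F \<Omega>] F True const[of ?l] Lp_norm_nonneg[of p \<Omega> F]
      by (intro exI[of _ "\<lambda>z. ?l"]) (auto simp: algebra_simps)
  next
    case False
    define q where "q = enn2real p"
    have q: "q > 1"
      using \<open>1 < p\<close> False unfolding q_def
      by (metis enn2real_1 enn2real_less_iff ennreal_enn2real ennreal_less_iff infinity_ennreal_def less_top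
          ennreal_1 zero_le_one)
    define I where "I = (LINT z|?M. norm (F z) powr q)"
    have int: "integrable ?M (\<lambda>z. norm (F z) powr q)"
      by (rule bc_space_Lp_integrable_powr[OF F False q_def q])
    have l: "?l = I powr (1 / q)" using False by (simp add: Lp_norm_def I_def q_def)
    have "I \<ge> 0" by (simp add: I_def)
    show ?thesis
    proof (cases "I = 0")
      case True
      then have "AE z in ?M. norm (F z) powr q = 0"
        using integral_nonneg_eq_0_iff_AE[OF int] by (simp add: I_def)
      then have "AE z in ?M. norm (F z) \<le> 0" by eventually_elim simp
      then show ?thesis
        using Lp_norm_nonneg[of p \<Omega> F] by (intro exI[of _ "\<lambda>z. 0"]) simp
    next
      case False
      with \<open>I \<ge> 0\<close> have "I > 0" by simp
      then have lpos: "?l > 0" by (simp add: l)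
      have lq: "?l powr q = I" using \<open>I > 0\<close> q by (simp add: l powr_powr)
      let ?h = "\<lambda>z. ?l powr (1 - q) * norm (F z) powr q + ?l"
      have le: "t \<le> ?l powr (1 - q) * t powr q + ?l" if "t \<ge> 0" for t
      proof (cases "t \<le> ?l")
        case True
        then show ?thesis by (simp add: add_increasing)
      next
        case False
        then have "t > 0" using lpos by simp
        have "?l powr (q - 1) \<le> t powr (q - 1)"
          using False lpos q by (intro powr_mono2) auto
        then have "?l powr (1 - q) * ?l powr (q - 1) * t \<le> ?l powr (1 - q) * t powr (q - 1) * t"
          using \<open>t > 0\<close> by (intro mult_right_mono mult_left_mono) auto
        moreover have "?l powr (1 - q) * ?l powr (q - 1) = 1"
          using lpos by (simp flip: powr_add)
        moreover have "t powr (q - 1) * t = t powr q"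
          using \<open>t > 0\<close> powr_add[of t "q - 1" 1] by simp
        ultimately show ?thesis using lpos by (simp add: mult.assoc)
      qed
      have "integrable ?M ?h" using int const(1) by simp
      moreover have "(LINT z|?M. ?h z) = ?l powr (1 - q) * I + ?m * ?l"
        using int const by (simp add: I_def)
      moreover have "?l powr (1 - q) * I = ?l"
        using lpos by (simp add: powr_add[symmetric] flip: lq)
      ultimately show ?thesis
        using le by (intro exI[of _ ?h]) (simp add: algebra_simps)
    qed
  qed
  then obtain h where h: "integrable ?M h" "AE z in ?M. norm (F z) \<le> h z" "(LINT z|?M. h z) \<le> (1 + ?m) * ?l"
    by blast
  show int: "integrable ?M F"
    by (rule Bochner_Integration.integrable_bound[OF h(1)]) (use h(2) in \<open>auto elim: eventually_mono\<close>)
  have "(LINT z|?M. norm (F z)) \<le> (LINT z|?M. h z)"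
    by (rule integral_mono_AE) (use int h in auto)
  with h(3) show "(LINT z|?M. norm (F z)) \<le> (1 + ?m) * ?l" by simp
qed

section \<open>Borel representatives\<close>

lemma lebesgue_on_borel_version_real:
  fixes f :: "complex \<Rightarrow> real"
  assumes f: "f \<in> borel_measurable (lebesgue_on \<Omega>)" and \<Omega>: "\<Omega> \<in> sets lebesgue"
  shows "\<exists>g\<in>borel_measurable borel. AE z in lborel. z \<in> \<Omega> \<longrightarrow> g z = f z"
proof -
  obtain g where "g \<in> borel_measurable lborel" "AE z in lborel. (if z \<in> \<Omega> then f z else 0) = g z"
    using completion_ex_borel_measurable_real[OF borel_measurable_if_I[OF f \<Omega>]] by auto
  then show ?thesis
    by (intro bexI[of _ g]) (auto elim: eventually_mono)
qed

text \<open>Solutions are Lebesgue measurable on the domain, while the Fubini arguments take place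
  on products of \<open>lborel\<close>. The extension by 0 lets integrals over the domain become
  integrals over the plane.\<close>

lemma lebesgue_on_borel_version:
  fixes f :: "complex \<Rightarrow> bicomplex"
  assumes f: "f \<in> borel_measurable (lebesgue_on \<Omega>)" and \<Omega>: "open \<Omega>"
  obtains g where "g \<in> borel_measurable borel" "\<And>z. z \<notin> \<Omega> \<Longrightarrow> g z = 0"
    "AE z in lborel. z \<in> \<Omega> \<longrightarrow> g z = f z"
proof -
  note [measurable] = f
  have \<Omega>': "\<Omega> \<in> sets lebesgue" "\<Omega> \<in> sets borel" using \<Omega> by auto
  note [measurable] = \<Omega>'(2)
  have ex: "\<exists>g\<in>borel_measurable borel. AE z in lborel. z \<in> \<Omega> \<longrightarrow> g z = h z"
    if "h \<in> borel_measurable (lebesgue_on \<Omega>)" for h :: "complex \<Rightarrow> real"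
    using lebesgue_on_borel_version_real[OF that \<Omega>'(1)] .
  obtain g1 where g1 [measurable]: "g1 \<in> borel_measurable borel" "AE z in lborel. z \<in> \<Omega> \<longrightarrow> g1 z = Re (Sc (f z))"
    using ex[of "\<lambda>z. Re (Sc (f z))"] by auto
  obtain g2 where g2 [measurable]: "g2 \<in> borel_measurable borel" "AE z in lborel. z \<in> \<Omega> \<longrightarrow> g2 z = Im (Sc (f z))"
    using ex[of "\<lambda>z. Im (Sc (f z))"] by auto
  obtain g3 where g3 [measurable]: "g3 \<in> borel_measurable borel" "AE z in lborel. z \<in> \<Omega> \<longrightarrow> g3 z = Re (Vec (f z))"
    using ex[of "\<lambda>z. Re (Vec (f z))"] by auto
  obtain g4 where g4 [measurable]: "g4 \<in> borel_measurable borel" "AE z in lborel. z \<in> \<Omega> \<longrightarrow> g4 z = Im (Vec (f z))"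
    using ex[of "\<lambda>z. Im (Vec (f z))"] by auto
  define g where "g z = indicator \<Omega> z *\<^sub>R (g1 z *\<^sub>R Bicomplex 1 0 + g2 z *\<^sub>R Bicomplex \<i> 0 +
       g3 z *\<^sub>R Bicomplex 0 1 + g4 z *\<^sub>R Bicomplex 0 \<i>)" for z
  show ?thesis
  proof
    show "g \<in> borel_measurable borel" unfolding g_def[abs_def] by measurable
    show "g z = 0" if "z \<notin> \<Omega>" for z using that by (simp add: g_def)
    show "AE z in lborel. z \<in> \<Omega> \<longrightarrow> g z = f z"
      using g1(2) g2(2) g3(2) g4(2)
      by eventually_elim (simp add: g_def flip: bicomplex_decompose_scaleR)
  qed
qed

lemma integral_borel_version:
  fixes f g :: "complex \<Rightarrow> 'a::euclidean_space"
  assumes f: "f \<in> borel_measurable (lebesgue_on \<Omega>)" and \<Omega>: "open \<Omega>"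
    and g: "g \<in> borel_measurable borel" "\<And>z. z \<notin> \<Omega> \<Longrightarrow> g z = 0" "AE z in lborel. z \<in> \<Omega> \<longrightarrow> g z = f z"
  shows "(LINT z|lebesgue_on \<Omega>. f z) = (LINT z|lborel. g z)"
    and "integrable (lebesgue_on \<Omega>) f \<longleftrightarrow> integrable lborel g"
proof -
  have \<Omega>': "\<Omega> \<inter> space lebesgue \<in> sets lebesgue" using \<Omega> by auto
  have m: "(\<lambda>z. indicator \<Omega> z *\<^sub>R f z) \<in> borel_measurable lebesgue" "g \<in> borel_measurable lebesgue"
    using f g(1) \<Omega> by (auto simp: borel_measurable_restrict_space_iff[OF \<Omega>'] intro: measurable_completion)
  have AE: "AE z in lebesgue. indicator \<Omega> z *\<^sub>R f z = g z"
    using AE_completion[OF g(3)] by eventually_elim (use g(2) in \<open>auto simp: indicator_def\<close>)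
  have "(LINT z|lebesgue_on \<Omega>. f z) = (LINT z|lebesgue. indicator \<Omega> z *\<^sub>R f z)"
    by (rule integral_restrict_space[OF \<Omega>'])
  also have "\<dots> = (LINT z|lebesgue. g z)"
    by (rule integral_cong_AE[OF m AE])
  also have "\<dots> = (LINT z|lborel. g z)"
    using g(1) by (simp add: integral_completion)
  finally show "(LINT z|lebesgue_on \<Omega>. f z) = (LINT z|lborel. g z)" .
  have "integrable (lebesgue_on \<Omega>) f \<longleftrightarrow> integrable lebesgue (\<lambda>z. indicator \<Omega> z *\<^sub>R f z)"
    by (rule integrable_restrict_space[OF \<Omega>'])
  also have "\<dots> \<longleftrightarrow> integrable lebesgue g"
    by (rule integrable_cong_AE[OF m AE])
  also have "\<dots> \<longleftrightarrow> integrable lborel g"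
    using g(1) by (simp add: integrable_completion)
  finally show "integrable (lebesgue_on \<Omega>) f \<longleftrightarrow> integrable lborel g" .
qed

section \<open>Solutions of the Vekua equation\<close>

lemma norm_kern_le_const: "e > 0 \<Longrightarrow> norm (kern e w) \<le> 1 + 1 / e"
proof -
  assume e: "e > 0"
  have pos: "(cmod w)\<^sup>2 + e > 0" using e by (simp add: add_nonneg_pos)
  \<comment> \<open>This is (1 + 1/e)(|w|^2 + e) - |w| with the square completed in |w|.\<close>
  have "0 \<le> (cmod w - 1 / 2)\<^sup>2 + 3 / 4 + (cmod w)\<^sup>2 / e + e" using e by simp
  then have "cmod w \<le> (1 + 1 / e) * ((cmod w)\<^sup>2 + e)"
    using e by (simp add: power2_eq_square field_simps)
  then show ?thesis
    using pos by (simp add: kern_def pos_divide_le_eq divide_inverse[symmetric] mult.commute)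
qed

lemma test_fn_eq_kern: "test_fn z0 s \<zeta> e z = cutoff z0 s z *\<^sub>R kern e (z - \<zeta>)"
  by (simp add: test_fn_def kern_def jc_scaleR divide_inverse)

text \<open>The passage from the weak equation to \<open>local_sol\<close>: test with
  \<open>test_fn\<close> and replace all functions by Borel versions on the plane. M bounds the
  right-hand side of the equation by the norm of W, the 4 being the product constant of the
  bicomplex norm.\<close>

lemma vekua_bergman_local_sol:
  assumes \<Omega>: "open \<Omega>" "bounded \<Omega>" and a: "a \<in> bc_space (Lp \<infinity> \<Omega>)" and b: "b \<in> bc_space (Lp \<infinity> \<Omega>)" and p: "1 < p"
    and W: "W \<in> vekua_bergman p \<Omega> a b"
  defines "M \<equiv> 4 * (Lp_norm \<infinity> \<Omega> a + Lp_norm \<infinity> \<Omega> b)"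
  obtains W' V where "\<And>z0 R. cball z0 R \<subseteq> \<Omega> \<Longrightarrow> local_sol M z0 R W' V"
    "AE z in lborel. z \<in> \<Omega> \<longrightarrow> W' z = W z"
    "(LINT z|lborel. norm (W' z)) = (LINT z|lebesgue_on \<Omega>. norm (W z))"
proof -
  have M: "M \<ge> 0" by (simp add: M_def Lp_norm_nonneg)
  have lm: "\<Omega> \<in> lmeasurable" using \<Omega> by (simp add: bounded_set_imp_lmeasurable)
  define v where "v z = a z * W z + b z * bcnj (W z)" for z
  have Wp: "W \<in> bc_space (Lp p \<Omega>)" and weak: "weak_dbar \<Omega> W v"
    using W by (auto simp: vekua_bergman_def v_def[abs_def])
  note [measurable] = bc_space_Lp_measurable[OF a] bc_space_Lp_measurable[OF b] bc_space_Lp_measurable[OF Wp]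
  have v [measurable]: "v \<in> borel_measurable (lebesgue_on \<Omega>)"
    unfolding v_def[abs_def] by measurable
  have v_le: "AE z in lebesgue_on \<Omega>. norm (v z) \<le> M * norm (W z)"
    using Lp_norm_inf_AE[OF a] Lp_norm_inf_AE[OF b]
  proof eventually_elim
    fix z assume le: "norm (a z) \<le> Lp_norm \<infinity> \<Omega> a" "norm (b z) \<le> Lp_norm \<infinity> \<Omega> b"
    have "norm (v z) \<le> 4 * (norm (a z) * norm (W z)) + 4 * (norm (b z) * norm (bcnj (W z)))"
      unfolding v_def by (intro order_trans[OF norm_triangle_ineq] add_mono norm_bicomplex_mult_le)
    also have "\<dots> \<le> 4 * (Lp_norm \<infinity> \<Omega> a * norm (W z)) + 4 * (Lp_norm \<infinity> \<Omega> b * norm (W z))"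
      using le by (intro add_mono mult_left_mono mult_mono) (auto simp: Lp_norm_nonneg)
    finally show "norm (v z) \<le> M * norm (W z)" by (simp add: M_def algebra_simps)
  qed
  obtain W' where W' [measurable]: "W' \<in> borel_measurable borel" and W'0: "\<And>z. z \<notin> \<Omega> \<Longrightarrow> W' z = 0"
    and W'W: "AE z in lborel. z \<in> \<Omega> \<longrightarrow> W' z = W z"
    using lebesgue_on_borel_version[OF bc_space_Lp_measurable[OF Wp] \<Omega>(1)] by blast
  obtain v' where v' [measurable]: "v' \<in> borel_measurable borel" and v'0: "\<And>z. z \<notin> \<Omega> \<Longrightarrow> v' z = 0"
    and v'v: "AE z in lborel. z \<in> \<Omega> \<longrightarrow> v' z = v z"
    using lebesgue_on_borel_version[OF v \<Omega>(1)] by blast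
  \<comment> \<open>The coefficient bound holds almost everywhere only. Setting V to 0 where it
    fails makes it hold everywhere and changes the function on a null set.\<close>
  define V where "V z = (if norm (v' z) \<le> M * norm (W' z) then v' z else 0)" for z
  have V [measurable]: "V \<in> borel_measurable borel"
    unfolding V_def[abs_def] by measurable
  have V_le: "norm (V z) \<le> M * norm (W' z)" for z
    using M by (simp add: V_def)
  have V0: "V z = 0" if "z \<notin> \<Omega>" for z
    using v'0[OF that] by (simp add: V_def)
  have \<Omega>': "\<Omega> \<inter> space lebesgue \<in> sets lebesgue" using \<Omega> by auto
  have "AE z in lebesgue. z \<in> \<Omega> \<longrightarrow> norm (v z) \<le> M * norm (W z)"
    using v_le by (simp add: AE_restrict_space_iff[OF \<Omega>'])
  then have "AE z in lborel. z \<in> \<Omega> \<longrightarrow> norm (v z) \<le> M * norm (W z)"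
    by (simp add: AE_completion_iff)
  with v'v W'W have Vv: "AE z in lborel. z \<in> \<Omega> \<longrightarrow> V z = v z"
    by eventually_elim (auto simp: V_def)
  have intW: "integrable lborel W'"
    using integral_borel_version(2)[OF bc_space_Lp_measurable[OF Wp] \<Omega>(1) W' W'0 W'W]
      Lp_imp_L1(1)[OF lm p Wp] by simp
  have intV: "integrable lborel V"
    by (rule Bochner_Integration.integrable_bound[where f = "\<lambda>z. M * norm (W' z)"])
       (use intW M V_le in auto)
  have norm_eq: "(LINT z|lebesgue_on \<Omega>. norm (W z)) = (LINT z|lborel. norm (W' z))"
  proof (rule integral_borel_version(1)[OF _ \<Omega>(1)])
    show "AE z in lborel. z \<in> \<Omega> \<longrightarrow> norm (W' z) = norm (W z)"
      using W'W by eventually_elim simp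
  qed (simp_all add: W'0)
  have sol: "local_sol M z0 R W' V" if R: "cball z0 R \<subseteq> \<Omega>" for z0 R
    unfolding local_sol_def
  proof (intro conjI allI impI)
    fix s e :: real and \<zeta> assume s: "0 < s" "s \<le> R" and e: "0 < e"
    let ?\<phi> = "test_fn z0 s \<zeta> e" and ?k = "\<lambda>z. kern e (z - \<zeta>)"
    let ?A = "\<lambda>z. (e / ((cmod (z - \<zeta>))\<^sup>2 + e)\<^sup>2) *\<^sub>R (cutoff z0 s z *\<^sub>R W' z)"
    let ?C = "\<lambda>z. (cutoff' z0 s z *\<^sub>R (W' z * jc (z - z0))) * ?k z"
    let ?Y = "\<lambda>z. (cutoff z0 s z *\<^sub>R V z) * ?k z"
    have "cball z0 s \<subseteq> \<Omega>" using s R by auto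
    then have "?\<phi> \<in> bc_space (test_functions \<Omega>)"
      by (rule test_fn_test_functions[OF s(1) e])
    then have eq: "(LINT z|lebesgue_on \<Omega>. W z * dbar ?\<phi> z) = - (LINT z|lebesgue_on \<Omega>. v z * ?\<phi> z)"
      using weak by (simp add: weak_dbar_def)
    have d_eq: "dbar ?\<phi> z = (cutoff z0 s z * (e / ((cmod (z - \<zeta>))\<^sup>2 + e)\<^sup>2)) *\<^sub>R 1
        - cutoff' z0 s z *\<^sub>R (jc (z - z0) * ?k z)" for z
      using dbar_test_fn[OF e] by (simp add: kern_def)
    have d_meas: "dbar ?\<phi> \<in> borel_measurable borel"
      unfolding d_eq[abs_def] by measurable
    then have [measurable]: "dbar ?\<phi> \<in> borel_measurable (lebesgue_on \<Omega>)" "dbar ?\<phi> \<in> borel_measurable borel"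
      by (auto intro!: measurable_restrict_space1 measurable_completion)
    have t_meas: "?\<phi> \<in> borel_measurable borel"
      unfolding test_fn_eq_kern[abs_def] by measurable
    then have [measurable]: "?\<phi> \<in> borel_measurable (lebesgue_on \<Omega>)" "?\<phi> \<in> borel_measurable borel"
      by (auto intro!: measurable_restrict_space1 measurable_completion)
    have 1: "(LINT z|lebesgue_on \<Omega>. W z * dbar ?\<phi> z) = (LINT z|lborel. W' z * dbar ?\<phi> z)"
      by (rule integral_borel_version(1)[OF _ \<Omega>(1)])
         (measurable, simp add: W'0, use W'W in \<open>auto elim: eventually_mono\<close>)
    have 2: "(LINT z|lebesgue_on \<Omega>. v z * ?\<phi> z) = (LINT z|lborel. V z * ?\<phi> z)"
      by (rule integral_borel_version(1)[OF _ \<Omega>(1)])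
         (measurable, simp add: V0, use Vv in \<open>auto elim: eventually_mono\<close>)
    \<comment> \<open>For fixed e the kernels are bounded, so each of the three pieces is integrable
      separately and the tested equation may be rearranged term by term.\<close>
    have intA: "integrable lborel ?A"
    proof (rule Bochner_Integration.integrable_bound[where f = "\<lambda>z. 1 / e * norm (W' z)"])
      show "AE z in lborel. norm (?A z) \<le> norm (1 / e * norm (W' z))"
      proof (rule AE_I2)
        fix z
        have "e * e \<le> ((cmod (z - \<zeta>))\<^sup>2 + e)\<^sup>2"
          unfolding power2_eq_square[of "(cmod (z - \<zeta>))\<^sup>2 + e"] using e by (intro mult_mono) auto
        moreover have "(cmod (z - \<zeta>))\<^sup>2 + e > 0" using e by (simp add: add_nonneg_pos)
        ultimately have "e / ((cmod (z - \<zeta>))\<^sup>2 + e)\<^sup>2 \<le> 1 / e" using e by (simp add: field_simps)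
        moreover have "cutoff z0 s z * norm (W' z) \<le> 1 * norm (W' z)"
          using cutoff_bounds[of z0 s z] by (intro mult_right_mono) auto
        ultimately have "(e / ((cmod (z - \<zeta>))\<^sup>2 + e)\<^sup>2) * (cutoff z0 s z * norm (W' z)) \<le> 1 / e * (1 * norm (W' z))"
          using e cutoff_bounds[of z0 s z] by (intro mult_mono) auto
        then show "norm (?A z) \<le> norm (1 / e * norm (W' z))"
          using e cutoff_bounds[of z0 s z] by simp
      qed
    qed (use intW in auto)
    have k: "norm (U * ?k z) \<le> (1 + 1 / e) * norm U" for U z
      unfolding norm_mult_kern using mult_right_mono[OF norm_kern_le_const[OF e, of "z - \<zeta>"], of "norm U"]
      by (simp add: mult.commute)
    have intY: "integrable lborel ?Y"
    proof (rule Bochner_Integration.integrable_bound[where f = "\<lambda>z. (1 + 1 / e) * norm (V z)"])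
      show "AE z in lborel. norm (?Y z) \<le> norm ((1 + 1 / e) * norm (V z))"
      proof (rule AE_I2)
        fix z
        have "norm (?Y z) \<le> (1 + 1 / e) * norm (cutoff z0 s z *\<^sub>R V z)" by (rule k)
        also have "\<dots> \<le> (1 + 1 / e) * norm (V z)"
          using e cutoff_bounds[of z0 s z] by (intro mult_left_mono) (auto simp: mult_left_le_one_le)
        finally show "norm (?Y z) \<le> norm ((1 + 1 / e) * norm (V z))" using e by simp
      qed
    qed (use intV in auto)
    have intC: "integrable lborel ?C"
    proof (rule Bochner_Integration.integrable_bound[where f = "\<lambda>z. (1 + 1 / e) * (2 * s * norm (W' z))"])
      show "AE z in lborel. norm (?C z) \<le> norm ((1 + 1 / e) * (2 * s * norm (W' z)))"
      proof (rule AE_I2)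
        fix z
        have "cutoff' z0 s z * cmod (z - z0) \<le> 2 * s"
        proof (cases "z \<in> ball z0 s")
          case True
          then show ?thesis
            using cutoff_bounds[of z0 s z] s by (intro mult_mono) (auto simp: dist_norm norm_minus_commute)
        qed (use cutoff'_eq_0[OF s(1)] s in auto)
        then have "norm (cutoff' z0 s z *\<^sub>R (W' z * jc (z - z0))) \<le> 2 * s * norm (W' z)"
          using mult_right_mono[of "cutoff' z0 s z * cmod (z - z0)" "2 * s" "norm (W' z)"] cutoff_bounds[of z0 s z]
          by (simp add: norm_mult_jc mult_ac)
        then have "(1 + 1 / e) * norm (cutoff' z0 s z *\<^sub>R (W' z * jc (z - z0))) \<le> (1 + 1 / e) * (2 * s * norm (W' z))"
          using e by (intro mult_left_mono) auto
        with k[of "cutoff' z0 s z *\<^sub>R (W' z * jc (z - z0))" z]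
        show "norm (?C z) \<le> norm ((1 + 1 / e) * (2 * s * norm (W' z)))"
          using e s by simp
      qed
    qed (use intW in auto)
    have X: "W' z * dbar ?\<phi> z = ?A z - ?C z" for z
      unfolding d_eq by (simp add: right_diff_distrib mult.assoc mult.commute)
    have Y: "V z * ?\<phi> z = ?Y z" for z
      by (simp add: test_fn_eq_kern)
    have rhs: "cutoff_rhs z0 s W' V z * ?k z = ?Y z - ?C z" for z
      by (simp add: cutoff_rhs_def left_diff_distrib)
    from eq[unfolded 1 2 X Y] show "(LINT z|lborel. ?A z) = - (LINT z|lborel. cutoff_rhs z0 s W' V z * ?k z)"
      unfolding rhs Bochner_Integration.integral_diff[OF intA intC] Bochner_Integration.integral_diff[OF intY intC]
      by (simp add: algebra_simps)
  qed (use intW V V_le in auto)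
  show ?thesis by (rule that[OF sol W'W norm_eq[symmetric]])
qed

section \<open>Gluing local representatives\<close>

text \<open>The set where the two functions differ is open by continuity and negligible, hence
  empty.\<close>

lemma continuous_on_AE_eq_open:
  fixes f g :: "complex \<Rightarrow> bicomplex"
  assumes "open S" "continuous_on S f" "continuous_on S g" "AE x in lborel. x \<in> S \<longrightarrow> f x = g x" "x \<in> S"
  shows "f x = g x"
proof (rule ccontr)
  assume "f x \<noteq> g x"
  let ?D = "{x \<in> S. f x - g x \<in> - {0}}"
  have "?D = S \<inter> (\<lambda>x. f x - g x) -` (- {0})" by auto
  then have "open ?D"
    using continuous_on_open_vimage[OF \<open>open S\<close>, of "\<lambda>x. f x - g x"] assms(2,3)
    by (auto intro!: continuous_intros simp: Int_commute)
  moreover have "?D \<noteq> {}" using \<open>x \<in> S\<close> \<open>f x \<noteq> g x\<close> by auto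
  moreover have "AE x in lebesgue. x \<notin> ?D"
    using assms(4) by (intro AE_completion) (auto elim: eventually_mono)
  then have "negligible ?D"
    using AE_iff_null_sets[of ?D lebesgue] \<open>open ?D\<close> by (simp add: negligible_iff_null_sets)
  ultimately show False using open_not_negligible by blast
qed

text \<open>Two local representatives agree almost everywhere on the overlap of their balls, hence
  everywhere there by continuity. The value at x may therefore be taken from the ball centred at
  x.\<close>

lemma glue_local_representatives:
  fixes W :: "complex \<Rightarrow> bicomplex"
  assumes r: "\<And>z. z \<in> \<Omega> \<Longrightarrow> r z > 0" "\<And>z. z \<in> \<Omega> \<Longrightarrow> ball z (r z) \<subseteq> \<Omega>"
    and U: "\<And>z. z \<in> \<Omega> \<Longrightarrow> continuous_on (ball z (r z)) (U z)"
      "\<And>z. z \<in> \<Omega> \<Longrightarrow> AE x in lborel. x \<in> ball z (r z) \<longrightarrow> U z x = W x"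
  obtains V where "continuous_on \<Omega> V" "AE x in lborel. x \<in> \<Omega> \<longrightarrow> V x = W x"
    "\<And>z x. z \<in> \<Omega> \<Longrightarrow> x \<in> ball z (r z) \<Longrightarrow> V x = U z x"
proof -
  define V where "V x = U x x" for x
  have V: "V x = U z x" if "z \<in> \<Omega>" "x \<in> ball z (r z)" for z x
  proof -
    have "x \<in> \<Omega>" using r(2)[OF that(1)] that(2) by auto
    let ?S = "ball z (r z) \<inter> ball x (r x)"
    have "U x x = U z x"
    proof (rule continuous_on_AE_eq_open[where f = "U x" and g = "U z" and S = ?S])
      show "continuous_on ?S (U x)" "continuous_on ?S (U z)"
        using U(1)[OF \<open>x \<in> \<Omega>\<close>] U(1)[OF \<open>z \<in> \<Omega>\<close>] by (auto intro: continuous_on_subset)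
      show "AE y in lborel. y \<in> ?S \<longrightarrow> U x y = U z y"
        using U(2)[OF \<open>x \<in> \<Omega>\<close>] U(2)[OF \<open>z \<in> \<Omega>\<close>] by eventually_elim auto
      show "x \<in> ?S" using that r(1)[OF \<open>x \<in> \<Omega>\<close>] by auto
    qed auto
    then show ?thesis by (simp add: V_def)
  qed
  have cont: "continuous_on \<Omega> V"
  proof (intro continuous_at_imp_continuous_on ballI)
    fix x assume "x \<in> \<Omega>"
    have "continuous_on (ball x (r x)) V"
      by (rule continuous_on_eq[OF U(1)[OF \<open>x \<in> \<Omega>\<close>]]) (simp add: V[OF \<open>x \<in> \<Omega>\<close>])
    then show "isCont V x"
      using r(1)[OF \<open>x \<in> \<Omega>\<close>] by (simp add: continuous_on_eq_continuous_at)
  qed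
  \<comment> \<open>Lindelof reduces the cover to countably many balls, so that the exceptional null
    sets can be united.\<close>
  obtain \<F> where \<F>: "\<F> \<subseteq> (\<lambda>z. ball z (r z)) ` \<Omega>" "countable \<F>" "\<Union>\<F> = (\<Union>z\<in>\<Omega>. ball z (r z))"
    using Lindelof[of "(\<lambda>z. ball z (r z)) ` \<Omega>"] by auto
  have "AE x in lborel. \<forall>B\<in>\<F>. x \<in> B \<longrightarrow> V x = W x"
  proof (rule AE_ball_countable'[OF _ \<F>(2)])
    fix B assume "B \<in> \<F>"
    then obtain z where z: "z \<in> \<Omega>" "B = ball z (r z)" using \<F>(1) by auto
    show "AE x in lborel. x \<in> B \<longrightarrow> V x = W x"
      using U(2)[OF z(1)] by eventually_elim (use V[OF z(1)] z(2) in auto)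
  qed
  then have AE: "AE x in lborel. x \<in> \<Omega> \<longrightarrow> V x = W x"
  proof eventually_elim
    fix x assume *: "\<forall>B\<in>\<F>. x \<in> B \<longrightarrow> V x = W x"
    show "x \<in> \<Omega> \<longrightarrow> V x = W x"
    proof
      assume "x \<in> \<Omega>"
      then have "x \<in> \<Union>\<F>" unfolding \<F>(3) using r(1) by (intro UN_I[of x]) auto
      then show "V x = W x" using * by auto
    qed
  qed
  show ?thesis by (rule that[OF cont AE V])
qed

text \<open>Radii and constants are chosen for every centre before W is given, so the finite
  subcover of K and its constant serve all solutions. The balls around all points of the domain
  produce the global continuous representative.\<close>

theorem theorem22:
  fixes \<Omega> :: "complex set" and a b :: "complex \<Rightarrow> bicomplex" and p :: ennreal
    and K :: "complex set"
  assumes "open \<Omega>" and "connected \<Omega>" and "\<Omega> \<noteq> {}"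
    and "bounded \<Omega>" and "simply_connected \<Omega>"
    and "a \<in> bc_space (Lp \<infinity> \<Omega>)" and "b \<in> bc_space (Lp \<infinity> \<Omega>)"
    and "1 < p"
    and "compact K" and "K \<subseteq> \<Omega>"
  shows "\<exists>C>0. \<forall>W\<in>vekua_bergman p \<Omega> a b.
           \<exists>V. continuous_rep \<Omega> W V \<and> (\<forall>z\<in>K. norm (V z) \<le> C * Lp_norm p \<Omega> W)"
proof -
  define M where "M = 4 * (Lp_norm \<infinity> \<Omega> a + Lp_norm \<infinity> \<Omega> b)"
  have M: "M \<ge> 0" by (simp add: M_def Lp_norm_nonneg)
  define m where "m = 1 + measure lebesgue \<Omega>"
  have m: "m > 0" by (simp add: m_def add_pos_nonneg)
  let ?N = "\<lambda>W :: complex \<Rightarrow> bicomplex. LINT z|lborel. norm (W z)"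
  define good where "good z r C W U \<longleftrightarrow> continuous_on (ball z r) U \<and>
      (AE \<zeta> in lborel. \<zeta> \<in> ball z r \<longrightarrow> U \<zeta> = W \<zeta>) \<and> (\<forall>\<zeta>\<in>ball z r. norm (U \<zeta>) \<le> C * ?N W)" for z r C W U
  have "\<exists>r C. r > 0 \<and> C > 0 \<and> cball z (8 * r) \<subseteq> \<Omega> \<and>
      (\<forall>W V. local_sol M z (8 * r) W V \<longrightarrow> (\<exists>U. good z r C W U))" if z: "z \<in> \<Omega>" for z
  proof -
    obtain R where R: "R > 0" "cball z R \<subseteq> \<Omega>"
      using \<open>open \<Omega>\<close> z by (meson open_contains_cball)
    have r: "R / 4 > 0" using R by simp
    obtain C where "C > 0" "\<And>W V. local_sol M z (4 * (R / 4)) W V \<Longrightarrow>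
        \<exists>U. continuous_on (ball z (R / 4 / 2)) U \<and> (AE \<zeta> in lborel. \<zeta> \<in> ball z (R / 4 / 2) \<longrightarrow> U \<zeta> = W \<zeta>) \<and>
         (\<forall>\<zeta>\<in>ball z (R / 4 / 2). norm (U \<zeta>) \<le> C * ?N W)"
      by (rule local_sol_estimate[OF r M, of z]) (use that in blast)
    then have "C > 0 \<and> (\<forall>W V. local_sol M z R W V \<longrightarrow> (\<exists>U. good z (R / 8) C W U))"
      by (simp add: good_def)
    \<comment> \<open>The local estimate with r = R/4 uses the ball of radius 4 r = R and controls
      the one of radius r/2 = R/8.\<close>
    then show ?thesis using R by (intro exI[of _ "R / 8"] exI[of _ C]) simp
  qed
  then obtain \<rho> C where \<rho>C: "\<And>z. z \<in> \<Omega> \<Longrightarrow> \<rho> z > 0 \<and> C z > 0 \<and> cball z (8 * \<rho> z) \<subseteq> \<Omega> \<and>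
      (\<forall>W V. local_sol M z (8 * \<rho> z) W V \<longrightarrow> (\<exists>U. good z (\<rho> z) (C z) W U))"
    by metis
  have pos: "\<rho> z > 0" "C z > 0" and sub: "cball z (8 * \<rho> z) \<subseteq> \<Omega>"
    and est: "local_sol M z (8 * \<rho> z) W V \<Longrightarrow> \<exists>U. good z (\<rho> z) (C z) W U" if "z \<in> \<Omega>" for z W V
    using \<rho>C[OF that] by blast+
  have ball_sub: "ball z (\<rho> z) \<subseteq> \<Omega>" if "z \<in> \<Omega>" for z
  proof (rule subset_trans[OF _ sub[OF that]])
    show "ball z (\<rho> z) \<subseteq> cball z (8 * \<rho> z)" using pos(1)[OF that] by auto
  qed
  obtain T where T: "T \<subseteq> K" "finite T" "K \<subseteq> (\<Union>z\<in>T. ball z (\<rho> z))"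
  proof (rule compactE_image[OF \<open>compact K\<close>, of K "\<lambda>z. ball z (\<rho> z)"])
    show "K \<subseteq> (\<Union>z\<in>K. ball z (\<rho> z))"
    proof
      fix x assume "x \<in> K"
      then show "x \<in> (\<Union>z\<in>K. ball z (\<rho> z))"
        using pos(1)[of x] \<open>K \<subseteq> \<Omega>\<close> by (intro UN_I[of x]) auto
    qed
  qed (use that in auto)
  have T\<Omega>: "T \<subseteq> \<Omega>" using T(1) \<open>K \<subseteq> \<Omega>\<close> by auto
  \<comment> \<open>The sum dominates each local constant; the 1 keeps C0 positive when K, and with
    it T, is empty.\<close>
  define C0 where "C0 = 1 + (\<Sum>z\<in>T. C z)"
  have C_le: "C z \<le> C0" if "z \<in> T" for z
    using member_le_sum[of z T C] that T\<Omega> pos(2) T(2) by (force simp: C0_def intro: less_imp_le)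
  have C0: "C0 > 0"
    using sum_nonneg[of T C] T\<Omega> pos(2) by (force simp: C0_def intro: less_imp_le add_pos_nonneg)
  show ?thesis
  proof (intro exI[of _ "C0 * m"] conjI ballI)
    show "C0 * m > 0" using C0 m by simp
    fix W assume W: "W \<in> vekua_bergman p \<Omega> a b"
    obtain W' V' where W': "\<And>z0 R. cball z0 R \<subseteq> \<Omega> \<Longrightarrow> local_sol M z0 R W' V'"
      "AE z in lborel. z \<in> \<Omega> \<longrightarrow> W' z = W z"
      "?N W' = (LINT z|lebesgue_on \<Omega>. norm (W z))"
      unfolding M_def
      by (rule vekua_bergman_local_sol[OF \<open>open \<Omega>\<close> \<open>bounded \<Omega>\<close> assms(6,7) \<open>1 < p\<close> W]) (use that in blast)
    have N: "?N W' \<le> m * Lp_norm p \<Omega> W"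
      using Lp_imp_L1(2)[OF bounded_set_imp_lmeasurable[OF \<open>bounded \<Omega>\<close>] \<open>1 < p\<close>, of W] \<open>open \<Omega>\<close> W
      by (auto simp: W'(3) m_def vekua_bergman_def)
    have "\<exists>U. good z (\<rho> z) (C z) W' U" if "z \<in> \<Omega>" for z
      by (rule est[OF that W'(1)[OF sub[OF that]]])
    then obtain U where "\<And>z. z \<in> \<Omega> \<Longrightarrow> good z (\<rho> z) (C z) W' (U z)" by metis
    then have U: "\<And>z. z \<in> \<Omega> \<Longrightarrow> continuous_on (ball z (\<rho> z)) (U z)"
      "\<And>z. z \<in> \<Omega> \<Longrightarrow> AE \<zeta> in lborel. \<zeta> \<in> ball z (\<rho> z) \<longrightarrow> U z \<zeta> = W' \<zeta>"
      "\<And>z \<zeta>. z \<in> \<Omega> \<Longrightarrow> \<zeta> \<in> ball z (\<rho> z) \<Longrightarrow> norm (U z \<zeta>) \<le> C z * ?N W'"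
      unfolding good_def by blast+
    obtain V where V: "continuous_on \<Omega> V" "AE x in lborel. x \<in> \<Omega> \<longrightarrow> V x = W' x"
      "\<And>z x. z \<in> \<Omega> \<Longrightarrow> x \<in> ball z (\<rho> z) \<Longrightarrow> V x = U z x"
      by (rule glue_local_representatives[of \<Omega> \<rho> U W', OF pos(1) ball_sub U(1,2)]) (use that in blast)+
    have "AE x in lborel. x \<in> \<Omega> \<longrightarrow> V x = W x"
      using V(2) W'(2) by eventually_elim auto
    then have "continuous_rep \<Omega> W V"
      using V(1) \<open>open \<Omega>\<close> by (simp add: continuous_rep_def AE_restrict_space_iff AE_completion)
    moreover have "norm (V x) \<le> C0 * m * Lp_norm p \<Omega> W" if "x \<in> K" for x
    proof -
      from subsetD[OF T(3) that] obtain z where z: "z \<in> T" "x \<in> ball z (\<rho> z)" by (rule UN_E)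
      then have "norm (V x) \<le> C z * ?N W'" using V(3) U(3) T\<Omega> by auto
      also have "\<dots> \<le> C0 * (m * Lp_norm p \<Omega> W)"
        using C_le[OF z(1)] N C0 by (intro mult_mono) auto
      finally show ?thesis by (simp add: mult.assoc)
    qed
    ultimately show "\<exists>V. continuous_rep \<Omega> W V \<and> (\<forall>z\<in>K. norm (V z) \<le> C0 * m * Lp_norm p \<Omega> W)"
      by blast
  qed
qed

end
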